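(* Let $X$ and $Y$ be separable infinite-dimensional Banach spaces which are uniformly homeomorphic. Then for any $\lambda>d_u(X,Y)$ and any $\epsilon>0$ there is a $\lambda$-equivalent norm $|\cdot|$ on $Y$ such that $$\theta_{(Y,|\cdot|)}(\tau)\ge\theta_X(\tau/C)-\epsilon\qquad\text{for all }0\le\tau\le1,$$ where $C=32\lambda^2$.
   Context: For a uniformly continuous map $V:X\to Y$ between Banach spaces, $\omega(V,t)=\sup\{\|Vx-Vy\|:\|x-y\|\le t\}$ and $\|V\|_u=\lim_{t\to\infty}t^{-1}\omega(V,t)$. A uniform homeomorphism is a bijection $U:X\to Y$ with $U$ and $U^{-1}$ uniformly continuous. If $X$ and $Y$ are uniformly homeomorphic, $d_u(X,Y)=\inf\{\|U\|_u\|U^{-1}\|_u: U:X\to Y\text{ a uniform homeomorphism}\}$. For a separable infinite-dimensional Banach space $Z$ and $0\le\tau\le1$, $\theta_Z(\tau)$ is the greatest constant such that $\liminf_{n\to\infty}\|z^*+z_n^*\|\ge1+\theta_Z(\tau)$ whenever $z^*,z_n^*\in Z^*$, $\|z^*\|=1$, $z_n^*\to0$ weak$^*$ and $\liminf\|z_n^*\|\ge\tau$. $\theta_{(Y,|\cdot|)}$ is computed for $Y$ with the norm $|\cdot|$ (and its dual norm on $Y^*$). A norm $|\cdot|$ on $(Y,\|\cdot\|)$ is $\lambda$-equivalent if there are $a,b>0$ with $b/a\le\lambda$ and $a\|y\|\le|y|\le b\|y\|$ for all $y\in Y$. *)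

theory Defs
  imports "HOL-Analysis.Analysis"
begin

text \<open>A Banach space is a type of class \<open>banach\<close> (real scalars). Its dual is
  \<open>'a \<Rightarrow>\<^sub>L real\<close>.\<close>

definition separable_infinite_dimensional :: "'a::real_normed_vector itself \<Rightarrow> bool" where
  "separable_infinite_dimensional _ \<longleftrightarrow>
     separable_space (euclidean :: 'a topology) \<and> (\<nexists>B :: 'a set. finite B \<and> span B = UNIV)"

definition modulus :: "('a::real_normed_vector \<Rightarrow> 'b::real_normed_vector) \<Rightarrow> real \<Rightarrow> real" where
  "modulus V t = Sup {norm (V x - V y) | x y. norm (x - y) \<le> t}"

text \<open>For uniformly continuous \<open>V\<close> the supremum is finite for every \<open>t \<ge> 0\<close>, and the limit
  exists because \<open>modulus V\<close> is subadditive.\<close>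

definition unif_norm :: "('a::real_normed_vector \<Rightarrow> 'b::real_normed_vector) \<Rightarrow> real" where
  "unif_norm V = Lim at_top (\<lambda>t. modulus V t / t)"

definition uniform_homeomorphism ::
    "('a::real_normed_vector \<Rightarrow> 'b::real_normed_vector) \<Rightarrow> bool" where
  "uniform_homeomorphism U \<longleftrightarrow>
     bij U \<and> uniformly_continuous_on UNIV U \<and> uniformly_continuous_on UNIV (inv U)"

definition uniformly_homeomorphic ::
    "'a::real_normed_vector itself \<Rightarrow> 'b::real_normed_vector itself \<Rightarrow> bool" where
  "uniformly_homeomorphic _ _ \<longleftrightarrow> (\<exists>U :: 'a \<Rightarrow> 'b. uniform_homeomorphism U)"

text \<open>Meaningful only when the two spaces are uniformly homeomorphic; otherwise this is the
  infimum of the empty set.\<close>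

definition unif_dist ::
    "'a::real_normed_vector itself \<Rightarrow> 'b::real_normed_vector itself \<Rightarrow> real" where
  "unif_dist _ _ =
     Inf {unif_norm U * unif_norm (inv U) | U :: 'a \<Rightarrow> 'b. uniform_homeomorphism U}"

definition is_norm :: "('a::real_vector \<Rightarrow> real) \<Rightarrow> bool" where
  "is_norm N \<longleftrightarrow>
     (\<forall>x. 0 \<le> N x) \<and> (\<forall>x. N x = 0 \<longleftrightarrow> x = 0) \<and>
     (\<forall>r x. N (r *\<^sub>R x) = \<bar>r\<bar> * N x) \<and> (\<forall>x y. N (x + y) \<le> N x + N y)"

definition equivalent_norm :: "real \<Rightarrow> ('a::real_normed_vector \<Rightarrow> real) \<Rightarrow> bool" where
  "equivalent_norm l N \<longleftrightarrow>
     is_norm N \<and>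
     (\<exists>a b. 0 < a \<and> 0 < b \<and> b / a \<le> l \<and> (\<forall>x. a * norm x \<le> N x \<and> N x \<le> b * norm x))"

text \<open>The norm dual to an equivalent norm \<open>N\<close>. Since \<open>N\<close> is equivalent to \<open>norm\<close>, the
  \<open>N\<close>-continuous functionals are the elements of \<open>'a \<Rightarrow>\<^sub>L real\<close>. The quotient at \<open>x = 0\<close> is \<open>0\<close>,
  as in \<open>onorm\<close>.\<close>

definition dual_norm :: "('a::real_normed_vector \<Rightarrow> real) \<Rightarrow> ('a \<Rightarrow>\<^sub>L real) \<Rightarrow> real" where
  "dual_norm N f = (SUP x. \<bar>blinfun_apply f x\<bar> / N x)"

lemma dual_norm_norm: "dual_norm norm f = norm f"
  by (simp add: dual_norm_def norm_blinfun.rep_eq onorm_def)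

definition weak_star_null :: "(nat \<Rightarrow> 'a::real_normed_vector \<Rightarrow>\<^sub>L real) \<Rightarrow> bool" where
  "weak_star_null zs \<longleftrightarrow> (\<forall>x. (\<lambda>n. blinfun_apply (zs n) x) \<longlonglongrightarrow> 0)"

text \<open>\<open>theta N \<tau>\<close> is computed for the space equipped with the norm \<open>N\<close>. The limits inferior are
  taken in the extended reals.\<close>

definition theta :: "('a::real_normed_vector \<Rightarrow> real) \<Rightarrow> real \<Rightarrow> real" where
  "theta N \<tau> = (GREATEST c :: real.
     \<forall>(z :: 'a \<Rightarrow>\<^sub>L real) zs.
       dual_norm N z = 1 \<and> weak_star_null zs \<and>
       liminf (\<lambda>n. ereal (dual_norm N (zs n))) \<ge> ereal \<tau>
       \<longrightarrow> liminf (\<lambda>n. ereal (dual_norm N (z + zs n))) \<ge> ereal (1 + c))"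

end

theory Submission
  imports Defs
begin

text \<open>A uniform homeomorphism \<open>U\<close> is Lipschitz at large distances. For a functional \<open>f\<close> on the target let
  \<open>osc s f\<close> be the supremum of the difference quotients of \<open>f \<circ> U\<close> over pairs at distance at least \<open>s\<close>. These
  are dual norms, and the new norm is the one whose dual norm is the average of \<open>osc s\<close> over the scales
  \<open>s = 4 ^ k * s0\<close>. Given \<open>f\<close> and a weak* null sequence \<open>zs\<close>, take a pair \<open>m + u\<close>, \<open>m - u\<close> that almost attains
  \<open>osc (4 * s) f\<close>. By duality, \<open>\<theta>\<close> of the source bounds the norm of \<open>u + z\<close> and \<open>u - z\<close> for \<open>z\<close> of controlled
  norm in a weak neighbourhood of \<open>0\<close>. By the Gorelik principle the points \<open>U (m + z)\<close> with such \<open>z\<close> cover a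
  ball up to a finite set of translations, so \<open>z\<close> can be chosen with \<open>zs n\<close> very negative at \<open>U (m + z)\<close>.
  The pair \<open>m + u\<close>, \<open>m + z\<close> then shows that \<open>osc s (f + zs n)\<close> is large.\<close>

section \<open>The Hahn--Banach theorem\<close>

text \<open>One scale is not enough. \<open>osc s\<close> decreases in \<open>s\<close>, the
  estimate bounds \<open>osc s (f + zs n)\<close> from below through \<open>osc (4 * s) f\<close>,
  and the drop from \<open>osc s f\<close> to \<open>osc (4 * s) f\<close> need not be small for a
  given \<open>f\<close> and \<open>s\<close>. Summed over consecutive scales the drops telescope,
  which is why the norm is an average. One norm has to serve all \<tau>, so the number of scales and
  the smallest scale may depend on \<epsilon> but not on \<tau>. This works because only values
  \<open>c > \<epsilon>\<close> of \<theta> of the source need an argument (\<theta> is never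
  negative): the radius \<open>c / t\<close> in the smoothness estimate then stays above \<epsilon>,
  and the smallest scale is chosen against \<epsilon>. The constant: with
  \<open>t = \<tau> / (32 * l\<^sup>2)\<close> the sequence contributes a gain
  \<open>c / t / (3 * b) * \<mu>\<close>. The Gorelik principle costs the factor
  \<open>3 * b\<close>, passing from the new dual norm to \<open>norm (zs n)\<close> costs
  \<open>2 * a\<close>, and \<open>a * b \<le> l\<close> with \<open>1 \<le> l\<close> leaves at
  least \<open>32 / 6 * c\<close>, more than the \<open>5 * c\<close> used in the final
  arithmetic.\<close>

definition sublinear :: "('a::real_vector \<Rightarrow> real) \<Rightarrow> bool" where
  "sublinear p \<longleftrightarrow> (\<forall>x y. p (x + y) \<le> p x + p y) \<and> (\<forall>t x. 0 \<le> t \<longrightarrow> p (t *\<^sub>R x) = t * p x)"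

lemma sublinear_add: "sublinear p \<Longrightarrow> p (x + y) \<le> p x + p y"
  and sublinear_scaleR: "sublinear p \<Longrightarrow> 0 \<le> t \<Longrightarrow> p (t *\<^sub>R x) = t * p x"
  by (auto simp: sublinear_def)

lemma sublinear_zero: "sublinear p \<Longrightarrow> p 0 = 0"
  using sublinear_scaleR[of p 0 0] by simp

lemma sublinear_minus: "sublinear p \<Longrightarrow> - p (- x) \<le> p x"
  using sublinear_add[of p x "- x"] sublinear_zero[of p] by simp

text \<open>Sliding along the ray of \<open>a\<close> and subtracting \<open>t * p a\<close> lowers
  \<open>p\<close> as far as \<open>- p a\<close> at \<open>- a\<close>, so every linear minorant of
  \<open>q\<close> takes the value \<open>p a\<close> at \<open>a\<close>. Subadditivity keeps the
  infimum finite, bounded below by \<open>- p (- x)\<close>.\<close>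

lemma sublinear_shift:
  fixes p :: "'a::real_vector \<Rightarrow> real"
  assumes p: "sublinear p"
  obtains q where "sublinear q" "q \<le> p" "q (- a) \<le> - p a"
proof -
  define S where "S x = (\<lambda>t. p (x + t *\<^sub>R a) - t * p a) ` {0..}" for x
  define q where "q x = Inf (S x)" for x
  have lower: "- p (- x) \<le> p (x + t *\<^sub>R a) - t * p a" if "0 \<le> t" for x t
    using sublinear_add[OF p, of "x + t *\<^sub>R a" "- x"] sublinear_scaleR[OF p that, of a] by simp
  have bdd: "bdd_below (S x)" for x
    unfolding S_def using lower by (intro bdd_belowI2[of _ "- p (- x)"]) auto
  have ne: "S x \<noteq> {}" for x by (auto simp: S_def)
  have q_le: "q x \<le> p (x + t *\<^sub>R a) - t * p a" if "0 \<le> t" for x t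
    unfolding q_def using that by (intro cInf_lower bdd) (auto simp: S_def)
  have approx: "\<exists>t\<ge>0. p (x + t *\<^sub>R a) - t * p a < q x + e" if "0 < e" for x e
    using cInf_lessD[OF ne[of x], of "q x + e"] that by (auto simp: q_def S_def)
  have add: "q (x + y) \<le> q x + q y" for x y
  proof (rule field_le_epsilon)
    fix e :: real assume "0 < e"
    then obtain s t where st: "0 \<le> s" "0 \<le> t" "p (x + s *\<^sub>R a) - s * p a < q x + e/2"
      "p (y + t *\<^sub>R a) - t * p a < q y + e/2"
      using approx[of "e/2" x] approx[of "e/2" y] by auto
    have "q (x + y) \<le> p ((x + s *\<^sub>R a) + (y + t *\<^sub>R a)) - (s + t) * p a"
      using q_le[of "s + t" "x + y"] st by (simp add: algebra_simps)
    also have "\<dots> \<le> q x + q y + e"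
      using sublinear_add[OF p, of "x + s *\<^sub>R a" "y + t *\<^sub>R a"] st by (simp add: algebra_simps)
    finally show "q (x + y) \<le> q x + q y + e" .
  qed
  have scale_le: "q (r *\<^sub>R x) \<le> r * q x" if r: "0 < r" for r x
  proof (rule field_le_epsilon)
    fix e :: real assume "0 < e"
    then obtain t where t: "0 \<le> t" "p (x + t *\<^sub>R a) - t * p a < q x + e/r"
      using approx[of "e/r" x] r by auto
    have "q (r *\<^sub>R x) \<le> p (r *\<^sub>R (x + t *\<^sub>R a)) - (r * t) * p a"
      using q_le[of "r * t" "r *\<^sub>R x"] t r by (simp add: algebra_simps)
    also have "\<dots> = r * (p (x + t *\<^sub>R a) - t * p a)"
      using sublinear_scaleR[OF p, of r "x + t *\<^sub>R a"] r by (simp add: algebra_simps)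
    also have "\<dots> \<le> r * (q x + e/r)"
      using t r by (intro mult_left_mono) auto
    finally show "q (r *\<^sub>R x) \<le> r * q x + e" using r by (simp add: algebra_simps)
  qed
  have q0: "q 0 = 0"
    using q_le[of 0 0] add[of 0 0] sublinear_zero[OF p] by simp
  have scale: "q (r *\<^sub>R x) = r * q x" if r: "0 \<le> r" for r x
  proof (cases "r = 0")
    case False
    then have r': "0 < r" "0 < 1/r" using r by auto
    have "q x \<le> (1/r) * q (r *\<^sub>R x)"
      using scale_le[OF r'(2), of "r *\<^sub>R x"] r' by simp
    then have "r * q x \<le> q (r *\<^sub>R x)" using r' by (simp add: field_simps)
    then show ?thesis using scale_le[OF r'(1), of x] by simp
  qed (simp add: q0)
  show ?thesis
  proof (rule that)
    show "sublinear q" using add scale by (auto simp: sublinear_def)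
    show "q \<le> p" using q_le[of 0] by (auto simp: le_fun_def)
    show "q (- a) \<le> - p a" using q_le[of 1 "- a"] sublinear_zero[OF p] by simp
  qed
qed

text \<open>A minimal sublinear functional is linear, since it cannot be lowered by \<open>sublinear_shift\<close>.\<close>

lemma minimal_sublinear:
  fixes p :: "'a::real_vector \<Rightarrow> real"
  assumes p: "sublinear p"
  obtains f where "linear f" "f \<le> p"
proof -
  let ?A = "{q. sublinear q \<and> q \<le> p}"
  let ?P = "\<lambda>q r :: 'a \<Rightarrow> real. r \<le> q"
  \<comment> \<open>Zorn's lemma for the reversed pointwise order: bounds of chains are pointwise
    infima.\<close>
  have "\<exists>m\<in>?A. \<forall>q\<in>?A. ?P m q \<longrightarrow> q = m"
  proof (rule predicate_Zorn)
    show "partial_order_on ?A (relation_of ?P ?A)"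
      by (rule partial_order_on_relation_ofI) auto
  next
    fix C assume C: "C \<in> Chains (relation_of ?P ?A)"
    show "\<exists>u\<in>?A. \<forall>q\<in>C. u \<le> q"
    proof (cases "C = {}")
      case True
      then show ?thesis using p by auto
    next
      case ne: False
      have mem: "sublinear q" "q \<le> p" if "q \<in> C" for q
        using C that unfolding Chains_def relation_of_def by auto
      have total: "q \<le> r \<or> r \<le> q" if "q \<in> C" "r \<in> C" for q r
        using C that unfolding Chains_def relation_of_def by auto
      define u where "u x = (INF q\<in>C. q x)" for x
      have bdd: "bdd_below ((\<lambda>q. q x) ` C)" for x
      proof (rule bdd_belowI2[of _ "- p (- x)"])
        fix q assume "q \<in> C"
        then have "- q (- x) \<le> q x" "q (- x) \<le> p (- x)"
          using sublinear_minus[of q x] mem by (auto simp: le_fun_def)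
        then show "- p (- x) \<le> q x" by simp
      qed
      have u_le: "u x \<le> q x" if "q \<in> C" for q x
        unfolding u_def using that bdd by (intro cINF_lower) auto
      have u_ge: "c \<le> u x" if "\<And>q. q \<in> C \<Longrightarrow> c \<le> q x" for c x
        unfolding u_def using that ne by (intro cINF_greatest) auto
      have approx: "\<exists>q\<in>C. q x < u x + e" if "0 < e" for x e
        using cInf_lessD[of "(\<lambda>q. q x) ` C" "u x + e"] that ne by (auto simp: u_def)
      have "u (x + y) \<le> u x + u y" for x y
      proof (rule field_le_epsilon)
        fix e :: real assume "0 < e"
        then obtain q r where qr: "q \<in> C" "r \<in> C" "q x < u x + e/2" "r y < u y + e/2"
          using approx[of "e/2" x] approx[of "e/2" y] by auto
        \<comment> \<open>Subadditivity of the infimum needs a single member of the chain that is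
          nearly minimal at both points; the smaller of \<open>q\<close> and \<open>r\<close> is
          one.\<close>
        have "\<exists>s\<in>C. s x < u x + e/2 \<and> s y < u y + e/2"
        proof (cases "q \<le> r")
          case True
          then have "q y \<le> r y" by (simp add: le_fun_def)
          then show ?thesis using qr by (intro bexI[of _ q]) auto
        next
          case False
          then have "r x \<le> q x" using total[of q r] qr by (metis le_fun_def)
          then show ?thesis using qr by (intro bexI[of _ r]) auto
        qed
        then obtain s where s: "s \<in> C" "s x < u x + e/2" "s y < u y + e/2"
          by blast
        then show "u (x + y) \<le> u x + u y + e"
          using u_le[of s "x + y"] sublinear_add[OF mem(1)[of s], of x y] by simp
      qed
      moreover have "u (t *\<^sub>R x) = t * u x" if "0 \<le> t" for t x
      proof (cases "t = 0")
        case True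
        have "(\<lambda>q. q 0) ` C = {0::real}" using ne mem sublinear_zero by force
        then show ?thesis using True by (simp add: u_def)
      next
        case False
        then have t: "0 < t" using that by simp
        have "u (t *\<^sub>R x) / t \<le> u x"
        proof (rule u_ge)
          fix q assume "q \<in> C"
          then show "u (t *\<^sub>R x) / t \<le> q x"
            using u_le[of q "t *\<^sub>R x"] sublinear_scaleR[OF mem(1)[of q], of t x] t
            by (simp add: field_simps)
        qed
        moreover have "t * u x \<le> u (t *\<^sub>R x)"
        proof (rule u_ge)
          fix q assume "q \<in> C"
          then show "t * u x \<le> q (t *\<^sub>R x)"
            using u_le[of q x] sublinear_scaleR[OF mem(1)[of q], of t x] t by simp
        qed
        ultimately show ?thesis using t by (simp add: field_simps)
      qed
      ultimately have "sublinear u" by (auto simp: sublinear_def)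
      moreover have "u \<le> p" using ne u_le mem by (fastforce simp: le_fun_def intro: order_trans)
      ultimately show ?thesis using u_le by (intro bexI[of _ u]) (auto simp: le_fun_def)
    qed
  qed
  then obtain f where f: "sublinear f" "f \<le> p"
    and min: "\<And>q. sublinear q \<Longrightarrow> q \<le> f \<Longrightarrow> q = f"
    by (auto intro: order_trans)
  have neg: "f (- x) = - f x" for x
  proof -
    obtain q where q: "sublinear q" "q \<le> f" "q (- x) \<le> - f x"
      using sublinear_shift[OF f(1), where a = x] by blast
    then show ?thesis using min[of q] sublinear_minus[OF f(1), of x] by simp
  qed
  have "f (x + y) = f x + f y" for x y
    using sublinear_add[OF f(1), of x y] sublinear_add[OF f(1), of "- x" "- y"] neg[of x] neg[of y]
      neg[of "x + y"] by simp
  moreover have "f (t *\<^sub>R x) = t *\<^sub>R f x" for t x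
  proof (cases "0 \<le> t")
    case False
    then have "f ((- t) *\<^sub>R x) = (- t) * f x" by (intro sublinear_scaleR[OF f(1)]) simp
    then show ?thesis using neg[of "t *\<^sub>R x"] by simp
  qed (use sublinear_scaleR[OF f(1)] in simp)
  ultimately have "linear f" by (intro linearI) auto
  then show ?thesis using f that by blast
qed

lemma Hahn_Banach_sublinear:
  fixes p :: "'a::real_vector \<Rightarrow> real"
  assumes p: "sublinear p"
  obtains f where "linear f" "f \<le> p" "f a = p a"
proof -
  obtain q where q: "sublinear q" "q \<le> p" "q (- a) \<le> - p a"
    using sublinear_shift[OF p] by blast
  obtain f where f: "linear f" "f \<le> q" using minimal_sublinear[OF q(1)] by blast
  have "f (- a) \<le> - p a" using f(2) q(3) by (auto simp: le_fun_def intro: order_trans)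
  then have "p a \<le> f a" using linear_neg[OF f(1)] by simp
  moreover have "f \<le> p" using f q by (simp add: order_trans)
  ultimately show ?thesis using that f(1) by (meson le_fun_def order.antisym)
qed

lemma Hahn_Banach_blinfun:
  fixes p :: "'a::real_normed_vector \<Rightarrow> real"
  assumes p: "sublinear p" and le: "\<And>x. p x \<le> norm x"
  obtains f :: "'a \<Rightarrow>\<^sub>L real" where "\<And>x. blinfun_apply f x \<le> p x" "blinfun_apply f a = p a" "norm f \<le> 1"
proof -
  obtain f where f: "linear f" "f \<le> p" "f a = p a" using Hahn_Banach_sublinear[OF p] by blast
  have bound: "norm (f x) \<le> norm x * 1" for x
  proof -
    have "f x \<le> norm x" "f (- x) \<le> norm (- x)"
      using f(2) le by (meson le_fun_def order_trans)+
    then show ?thesis using linear_neg[OF f(1), of x] by (simp add: abs_if)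
  qed
  have "bounded_linear f"
    using f(1) bound by (intro bounded_linear_intro[of f 1])
      (auto simp: linear_add linear_scale)
  then have app: "blinfun_apply (Blinfun f) = f" by (rule bounded_linear_Blinfun_apply)
  have "norm (Blinfun f) \<le> 1"
    using bound by (intro norm_blinfun_bound) (auto simp: app mult.commute)
  then show ?thesis using that[of "Blinfun f"] f by (auto simp: app le_fun_def)
qed

lemma norming_functional:
  fixes x :: "'a::real_normed_vector"
  obtains f :: "'a \<Rightarrow>\<^sub>L real" where "norm f \<le> 1" "blinfun_apply f x = norm x"
  using Hahn_Banach_blinfun[of norm x] by (auto simp: sublinear_def norm_triangle_ineq)

text \<open>The distance to \<open>E\<close> is sublinear and dominated by the norm. A functional
  below it vanishes on \<open>E\<close>, as it is at most 0 at both \<open>x\<close> and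
  \<open>- x\<close>, and it can be made to attain the positive distance at
  \<open>a\<close>.\<close>

lemma annihilating_functional:
  fixes E :: "'a::real_normed_vector set"
  assumes E: "subspace E" "closed E" and a: "a \<notin> E"
  obtains f :: "'a \<Rightarrow>\<^sub>L real" where "blinfun_apply f a \<noteq> 0" "\<And>x. x \<in> E \<Longrightarrow> blinfun_apply f x = 0"
proof -
  let ?p = "\<lambda>x. infdist x E"
  have E0: "0 \<in> E" "E \<noteq> {}" using subspace_0[OF E(1)] by auto
  have approx: "\<exists>v\<in>E. norm (x - v) < ?p x + e" if "0 < e" for x e
  proof -
    have "\<exists>z\<in>dist x ` E. z < ?p x + e"
      using that E0 by (intro cInf_lessD) (auto simp: infdist_def)
    then show ?thesis by (auto simp: dist_norm)
  qed
  have le: "?p x \<le> norm (x - v)" if "v \<in> E" for x v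
    using infdist_le[OF that, of x] by (simp add: dist_norm)
  have "?p (x + y) \<le> ?p x + ?p y" for x y
  proof (rule field_le_epsilon)
    fix e :: real assume "0 < e"
    then obtain v w where vw: "v \<in> E" "w \<in> E" "norm (x - v) < ?p x + e/2" "norm (y - w) < ?p y + e/2"
      using approx[of "e/2" x] approx[of "e/2" y] by auto
    have "?p (x + y) \<le> norm ((x - v) + (y - w))"
      using le[of "v + w" "x + y"] subspace_add[OF E(1)] vw by (simp add: algebra_simps)
    then show "?p (x + y) \<le> ?p x + ?p y + e"
      using norm_triangle_ineq[of "x - v" "y - w"] vw by simp
  qed
  moreover have "?p (t *\<^sub>R x) = t * ?p x" if "0 \<le> t" for t x
  proof (cases "t = 0")
    case False
    then have t: "0 < t" using that by simp
    show ?thesis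
    proof (rule antisym)
      show "?p (t *\<^sub>R x) \<le> t * ?p x"
      proof (rule field_le_epsilon)
        fix e :: real assume "0 < e"
        then obtain v where v: "v \<in> E" "norm (x - v) < ?p x + e/t" using approx[of "e/t" x] t by auto
        have "?p (t *\<^sub>R x) \<le> norm (t *\<^sub>R (x - v))"
          using le[of "t *\<^sub>R v" "t *\<^sub>R x"] subspace_scale[OF E(1) v(1)] by (simp add: algebra_simps)
        also have "\<dots> \<le> t * (?p x + e/t)" using v t by (simp)
        finally show "?p (t *\<^sub>R x) \<le> t * ?p x + e" using t by (simp add: algebra_simps)
      qed
      show "t * ?p x \<le> ?p (t *\<^sub>R x)"
      proof (rule field_le_epsilon)
        fix e :: real assume "0 < e"
        then obtain v where v: "v \<in> E" "norm (t *\<^sub>R x - v) < ?p (t *\<^sub>R x) + e" using approx by blast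
        have "t * ?p x \<le> t * norm (x - (1/t) *\<^sub>R v)"
          using le[of "(1/t) *\<^sub>R v" x] subspace_scale[OF E(1) v(1)] t by simp
        also have "\<dots> = norm (t *\<^sub>R (x - (1/t) *\<^sub>R v))" using t by simp
        also have "\<dots> = norm (t *\<^sub>R x - v)" using t by (simp add: algebra_simps)
        finally show "t * ?p x \<le> ?p (t *\<^sub>R x) + e" using v by simp
      qed
    qed
  qed (use E0 in simp)
  ultimately have "sublinear ?p" by (auto simp: sublinear_def)
  then obtain f :: "'a \<Rightarrow>\<^sub>L real" where f: "\<And>x. blinfun_apply f x \<le> ?p x" "blinfun_apply f a = ?p a"
    using Hahn_Banach_blinfun[of ?p a] le[OF E0(1)] by (metis diff_zero)
  have "?p a \<noteq> 0" using in_closed_iff_infdist_zero[OF E(2) E0(2)] a by auto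
  moreover have "blinfun_apply f x = 0" if "x \<in> E" for x
    using f(1)[of x] f(1)[of "- x"] that subspace_neg[OF E(1) that] by (simp add: blinfun.minus_right)
  ultimately show ?thesis using that[of f] f by auto
qed

text \<open>A functional that annihilates \<open>span F\<close> but not \<open>a\<close> turns the
  larger span into the preimage of \<open>span F\<close> under a continuous projection along
  \<open>a\<close>.\<close>

lemma closed_span_finite:
  fixes F :: "'a::real_normed_vector set"
  assumes "finite F"
  shows "closed (span F)"
  using assms
proof induction
  case (insert a F)
  show ?case
  proof (cases "a \<in> span F")
    case True
    then show ?thesis using insert by (simp add: span_redundant)
  next
    case False
    obtain f :: "'a \<Rightarrow>\<^sub>L real" where f: "blinfun_apply f a \<noteq> 0" "\<And>x. x \<in> span F \<Longrightarrow> blinfun_apply f x = 0"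
      using annihilating_functional[OF subspace_span insert.IH False] by blast
    let ?r = "\<lambda>x. x - (blinfun_apply f x / blinfun_apply f a) *\<^sub>R a"
    have "span (insert a F) = ?r -` span F"
    proof (intro set_eqI iffI)
      fix x assume "x \<in> span (insert a F)"
      then obtain k where k: "x - k *\<^sub>R a \<in> span F" by (auto simp: span_insert)
      then have "blinfun_apply f x = k * blinfun_apply f a"
        using f(2) by (fastforce simp: blinfun.diff_right blinfun.scaleR_right)
      then show "x \<in> ?r -` span F" using k f(1) by simp
    qed (auto simp: span_insert)
    moreover have "closed (?r -` span F)"
      using insert.IH f(1)
      by (intro continuous_closed_vimage) (auto intro!: continuous_intros)
    ultimately show ?thesis by simp
  qed
qed simp

section \<open>Dual norms and the modulus \<open>\<theta>\<close>\<close>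

lemma dual_norm_bdd:
  assumes "equivalent_norm l N"
  shows "bdd_above (range (\<lambda>x. \<bar>blinfun_apply f x\<bar> / N x))"
proof -
  obtain a where a: "0 < a" "\<And>x. a * norm x \<le> N x" and N: "is_norm N"
    using assms by (auto simp: equivalent_norm_def)
  have "\<bar>blinfun_apply f x\<bar> / N x \<le> norm f / a" for x
  proof (cases "x = 0")
    case False
    then have "0 < a * norm x" using a by simp
    moreover have "\<bar>blinfun_apply f x\<bar> \<le> norm f * norm x" using norm_blinfun[of f x] by simp
    ultimately have "\<bar>blinfun_apply f x\<bar> / N x \<le> (norm f * norm x) / (a * norm x)"
      using a(2)[of x] by (intro frac_le) auto
    then show ?thesis using False by simp
  qed (use a in simp)
  then show ?thesis by (intro bdd_aboveI2)
qed

lemma norm_pos: "is_norm N \<Longrightarrow> x \<noteq> 0 \<Longrightarrow> 0 < N x"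
  by (metis is_norm_def order_le_less)

lemma dual_norm_upper:
  assumes "equivalent_norm l N"
  shows "\<bar>blinfun_apply f x\<bar> \<le> dual_norm N f * N x"
proof (cases "x = 0")
  case False
  then have "0 < N x" using assms by (auto simp: equivalent_norm_def intro: norm_pos)
  moreover have "\<bar>blinfun_apply f x\<bar> / N x \<le> dual_norm N f"
    unfolding dual_norm_def by (rule cSUP_upper[OF _ dual_norm_bdd[OF assms]]) simp
  ultimately show ?thesis by (simp add: field_simps)
next
  case True
  moreover have "N 0 = 0" using assms by (simp add: equivalent_norm_def is_norm_def)
  ultimately show ?thesis by simp
qed

lemma dual_norm_least:
  assumes "is_norm N" "0 \<le> c" "\<And>x. \<bar>blinfun_apply f x\<bar> \<le> c * N x"
  shows "dual_norm N f \<le> c"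
  unfolding dual_norm_def
proof (rule cSUP_least)
  fix x
  show "\<bar>blinfun_apply f x\<bar> / N x \<le> c"
  proof (cases "x = 0")
    case False
    then show ?thesis using assms(3)[of x] norm_pos[OF assms(1), of x] by (simp add: pos_divide_le_eq)
  qed (use assms(2) in simp)
qed simp

lemma dual_norm_nonneg: "equivalent_norm l N \<Longrightarrow> 0 \<le> dual_norm N f"
  unfolding dual_norm_def
  by (rule cSUP_upper2[OF dual_norm_bdd, where x = 0]) auto

lemma equivalent_normD: "equivalent_norm l N \<Longrightarrow> is_norm N"
  by (simp add: equivalent_norm_def)

lemma dual_norm_triangle:
  assumes N: "equivalent_norm l N"
  shows "dual_norm N (f + g) \<le> dual_norm N f + dual_norm N g"
proof (rule dual_norm_least[OF equivalent_normD[OF N]])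
  fix x
  show "\<bar>blinfun_apply (f + g) x\<bar> \<le> (dual_norm N f + dual_norm N g) * N x"
    using dual_norm_upper[OF N, of f x] dual_norm_upper[OF N, of g x]
    by (simp add: blinfun.add_left algebra_simps)
qed (simp add: dual_norm_nonneg[OF N])

lemma dual_norm_scaleR:
  assumes N: "equivalent_norm l N"
  shows "dual_norm N (r *\<^sub>R f) = \<bar>r\<bar> * dual_norm N f"
proof -
  have le: "dual_norm N (r *\<^sub>R f) \<le> \<bar>r\<bar> * dual_norm N f" for r f
  proof (rule dual_norm_least[OF equivalent_normD[OF N]])
    fix x
    have "\<bar>r\<bar> * \<bar>blinfun_apply f x\<bar> \<le> \<bar>r\<bar> * (dual_norm N f * N x)"
      using dual_norm_upper[OF N, of f x] by (intro mult_left_mono) auto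
    then show "\<bar>blinfun_apply (r *\<^sub>R f) x\<bar> \<le> \<bar>r\<bar> * dual_norm N f * N x"
      by (simp add: blinfun.scaleR_left abs_mult mult.assoc)
  qed (simp add: dual_norm_nonneg[OF N])
  show ?thesis
  proof (cases "r = 0")
    case True
    then show ?thesis by (simp add: dual_norm_def)
  next
    case False
    have "dual_norm N f \<le> \<bar>inverse r\<bar> * dual_norm N (r *\<^sub>R f)"
      using le[of "inverse r" "r *\<^sub>R f"] False by simp
    then have "\<bar>r\<bar> * dual_norm N f \<le> dual_norm N (r *\<^sub>R f)" using False by (simp add: field_simps)
    then show ?thesis using le[of r f] by simp
  qed
qed

lemma norm_le_dual_norm:
  assumes N: "equivalent_norm l N"
  obtains b where "0 < b" "\<And>f. norm f \<le> b * dual_norm N f"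
proof -
  obtain b where b: "0 < b" "\<And>x. N x \<le> b * norm x"
    using N by (auto simp: equivalent_norm_def)
  have "norm f \<le> b * dual_norm N f" for f
  proof (rule norm_blinfun_bound)
    fix x
    have "\<bar>blinfun_apply f x\<bar> \<le> dual_norm N f * N x" by (rule dual_norm_upper[OF N])
    also have "\<dots> \<le> dual_norm N f * (b * norm x)"
      using b dual_norm_nonneg[OF N] by (intro mult_left_mono) auto
    finally show "norm (blinfun_apply f x) \<le> b * dual_norm N f * norm x" by (simp add: mult_ac)
  qed (use b dual_norm_nonneg[OF N] in simp)
  then show ?thesis using that b by blast
qed

lemma equivalent_norm_norm: "equivalent_norm 1 norm"
  unfolding equivalent_norm_def is_norm_def by (auto simp: norm_triangle_ineq intro!: exI[of _ 1])

section \<open>Weak* null sequences in the dual of a separable space\<close>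

lemma dense_sequence:
  assumes "separable_infinite_dimensional TYPE('a::real_normed_vector)"
  obtains d :: "nat \<Rightarrow> 'a::real_normed_vector" where "\<And>x e. 0 < e \<Longrightarrow> \<exists>k. norm (x - d k) < e"
proof -
  obtain C :: "'a set" where C: "countable C" "closure C = UNIV"
    using assms by (auto simp: separable_infinite_dimensional_def separable_space_def)
  then have "C \<noteq> {}" by auto
  have "\<exists>k. norm (x - from_nat_into C k) < e" if e: "0 < e" for x e
  proof -
    have "x \<in> closure C" using C by simp
    then obtain c where c: "c \<in> C" "dist c x < e" using e by (meson closure_approachable)
    then obtain k where "from_nat_into C k = c"
      using from_nat_into_surj[OF C(1)] by blast
    then show ?thesis using c by (auto simp: dist_norm norm_minus_commute intro!: exI[of _ k])
  qed
  then show ?thesis using that by blast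
qed

lemma weak_star_null_dense:
  fixes zs :: "nat \<Rightarrow> 'a::real_normed_vector \<Rightarrow>\<^sub>L real"
  assumes d: "\<And>x e. 0 < e \<Longrightarrow> \<exists>k. norm (x - d k) < e"
    and M: "\<And>n. norm (zs n) \<le> M" and lim: "\<And>k. (\<lambda>n. blinfun_apply (zs n) (d k)) \<longlonglongrightarrow> 0"
  shows "weak_star_null zs"
  unfolding weak_star_null_def
proof (intro allI tendstoI)
  fix x and e :: real assume e: "0 < e"
  have M0: "0 \<le> M" using M[of 0] norm_ge_zero order_trans by blast
  obtain k where k: "norm (x - d k) < e / (2 * (M + 1))" using d[of "e / (2 * (M + 1))" x] e M0 by auto
  have "\<forall>\<^sub>F n in sequentially. \<bar>blinfun_apply (zs n) (d k)\<bar> < e / 2"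
    using tendstoD[OF lim, of "e/2" k] e by simp
  then show "\<forall>\<^sub>F n in sequentially. dist (blinfun_apply (zs n) x) 0 < e"
  proof eventually_elim
    case (elim n)
    have "\<bar>blinfun_apply (zs n) (x - d k)\<bar> \<le> norm (zs n) * norm (x - d k)"
      using norm_blinfun[of "zs n" "x - d k"] by simp
    also have "\<dots> \<le> (M + 1) * (e / (2 * (M + 1)))"
      using M[of n] M0 k by (intro mult_mono) auto
    also have "\<dots> = e / 2" using M0 by (simp add: field_simps)
    finally show ?case using elim unfolding blinfun.diff_right dist_real_def by linarith
  qed
qed

text \<open>Infinite dimension leaves a point outside the span of the first \<open>n\<close> members
  of a dense sequence, hence a normalized functional vanishing on all of them. These sequences test
  the definition of \<theta> and bound it from above.\<close>

lemma normalized_weak_star_null: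
  fixes N :: "'a::real_normed_vector \<Rightarrow> real"
  assumes sep: "separable_infinite_dimensional TYPE('a)" and N: "equivalent_norm l N"
  obtains zs where "weak_star_null zs" "\<And>n. dual_norm N (zs n) = 1"
proof -
  obtain d :: "nat \<Rightarrow> 'a" where d: "\<And>x e. 0 < e \<Longrightarrow> \<exists>k. norm (x - d k) < e"
    using dense_sequence[OF sep] by blast
  obtain b where b: "0 < b" "\<And>f. norm f \<le> b * dual_norm N f" using norm_le_dual_norm[OF N] by blast
  have "\<exists>f. dual_norm N f = 1 \<and> (\<forall>k\<le>n. blinfun_apply f (d k) = 0)" for n
  proof -
    have "span (d ` {..n}) \<noteq> UNIV" using sep by (auto simp: separable_infinite_dimensional_def)
    then obtain a where a: "a \<notin> span (d ` {..n})" by blast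
    obtain f :: "'a \<Rightarrow>\<^sub>L real" where f: "blinfun_apply f a \<noteq> 0"
        "\<And>x. x \<in> span (d ` {..n}) \<Longrightarrow> blinfun_apply f x = 0"
      using annihilating_functional[OF subspace_span closed_span_finite a] by auto
    have "f \<noteq> 0" using f(1) by auto
    then have pos: "0 < dual_norm N f"
      using b(2)[of f] dual_norm_nonneg[OF N, of f] by (cases "dual_norm N f = 0") auto
    have "blinfun_apply f (d k) = 0" if "k \<le> n" for k
      using that by (intro f(2) span_base) auto
    then show ?thesis
      using pos
      by (intro exI[of _ "(1 / dual_norm N f) *\<^sub>R f"])
        (simp add: dual_norm_scaleR[OF N] blinfun.scaleR_left)
  qed
  then obtain zs where zs: "\<And>n. dual_norm N (zs n) = 1" "\<And>n k. k \<le> n \<Longrightarrow> blinfun_apply (zs n) (d k) = 0"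
    by metis
  have "(\<lambda>n. blinfun_apply (zs n) (d k)) \<longlonglongrightarrow> 0" for k
    by (rule tendsto_eventually) (use zs(2) in \<open>auto simp: eventually_sequentially\<close>)
  moreover have "norm (zs n) \<le> b" for n using b(2)[of "zs n"] zs(1) by simp
  ultimately have "weak_star_null zs"
    using weak_star_null_dense[OF d, of zs b] by blast
  then show ?thesis using that zs(1) by blast
qed

lemma weak_star_null_scaleR:
  assumes "weak_star_null zs" and "\<And>n. \<bar>s n\<bar> \<le> M"
  shows "weak_star_null (\<lambda>n. s n *\<^sub>R zs n)"
  unfolding weak_star_null_def
proof
  fix x
  show "(\<lambda>n. blinfun_apply (s n *\<^sub>R zs n) x) \<longlonglongrightarrow> 0"
  proof (rule Lim_null_comparison)
    have "(\<lambda>n. M * \<bar>blinfun_apply (zs n) x\<bar>) \<longlonglongrightarrow> M * \<bar>0\<bar>"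
      using assms(1) unfolding weak_star_null_def by (intro tendsto_intros) auto
    then show "(\<lambda>n. M * \<bar>blinfun_apply (zs n) x\<bar>) \<longlonglongrightarrow> 0" by simp
  qed (simp add: blinfun.scaleR_left abs_mult assms(2) mult_right_mono)
qed

section \<open>The admissible constants in the definition of \<theta>\<close>

definition theta_bound :: "('a::real_normed_vector \<Rightarrow> real) \<Rightarrow> real \<Rightarrow> real \<Rightarrow> bool" where
  "theta_bound N \<tau> c \<longleftrightarrow> (\<forall>z zs. dual_norm N z = 1 \<and> weak_star_null zs \<and>
       liminf (\<lambda>n. ereal (dual_norm N (zs n))) \<ge> ereal \<tau>
       \<longrightarrow> liminf (\<lambda>n. ereal (dual_norm N (z + zs n))) \<ge> ereal (1 + c))"

lemma theta_eq: "theta N \<tau> = (GREATEST c. theta_bound N \<tau> c)"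
  by (simp add: theta_def theta_bound_def)

text \<open>Weak* lower semicontinuity of a dual norm: a vector that almost attains the norm of
  \<open>z\<close> does so for \<open>z + zs n\<close> eventually. Besides making the set of
  admissible constants nonempty, this settles the theorem whenever \<theta> of the source is at most
  \<epsilon>.\<close>

lemma theta_bound_0:
  assumes N: "equivalent_norm l N"
  shows "theta_bound N \<tau> 0"
  unfolding theta_bound_def
proof (intro allI impI)
  fix z zs
  assume *: "dual_norm N z = 1 \<and> weak_star_null zs \<and>
    ereal \<tau> \<le> liminf (\<lambda>n. ereal (dual_norm N (zs n)))"
  have "\<forall>\<^sub>F n in sequentially. y < ereal (dual_norm N (z + zs n))" if y: "y < ereal 1" for y
  proof -
    obtain c where c: "y < ereal c" "c < 1" using ereal_dense2[OF y] by (metis less_ereal.simps(1))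
    obtain x where x: "c < \<bar>blinfun_apply z x\<bar> / N x"
      using less_cSUP_iff[OF _ dual_norm_bdd[OF N], of c z] * c by (auto simp: dual_norm_def)
    have "(\<lambda>n. \<bar>blinfun_apply (z + zs n) x\<bar> / N x) \<longlonglongrightarrow> \<bar>blinfun_apply z x + 0\<bar> / N x"
      using * unfolding weak_star_null_def blinfun.add_left divide_inverse by (intro tendsto_intros) auto
    then have "\<forall>\<^sub>F n in sequentially. c < \<bar>blinfun_apply (z + zs n) x\<bar> / N x"
      using x by (intro order_tendstoD) auto
    then show ?thesis
    proof eventually_elim
      case (elim n)
      have "\<bar>blinfun_apply (z + zs n) x\<bar> / N x \<le> dual_norm N (z + zs n)"
        unfolding dual_norm_def by (rule cSUP_upper[OF _ dual_norm_bdd[OF N]]) simp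
      then have "ereal c < ereal (dual_norm N (z + zs n))" using elim by simp
      then show ?case by (rule less_trans[OF c(1)])
    qed
  qed
  then show "ereal (1 + 0) \<le> liminf (\<lambda>n. ereal (dual_norm N (z + zs n)))"
    by (simp add: le_Liminf_iff)
qed

text \<open>Test sequence: \<open>z = zs 0\<close> and the multiples
  \<open>\<tau> *\<^sub>R zs n\<close> of a normalized weak* null sequence, where the triangle
  inequality caps the norm at \<open>1 + \<tau>\<close>.\<close>

lemma theta_bound_le:
  fixes N :: "'a::real_normed_vector \<Rightarrow> real"
  assumes sep: "separable_infinite_dimensional TYPE('a)" and N: "equivalent_norm l N"
    and \<tau>: "0 \<le> \<tau>" and c: "theta_bound N \<tau> c"
  shows "c \<le> \<tau>"
proof -
  obtain zs where zs: "weak_star_null zs" "\<And>n. dual_norm N (zs n) = 1"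
    using normalized_weak_star_null[OF sep N] by blast
  have "ereal (1 + c) \<le> liminf (\<lambda>n. ereal (dual_norm N (zs 0 + \<tau> *\<^sub>R zs n)))"
    using c[unfolded theta_bound_def, rule_format, of "zs 0" "\<lambda>n. \<tau> *\<^sub>R zs n"]
      weak_star_null_scaleR[OF zs(1), of "\<lambda>_. \<tau>" "\<bar>\<tau>\<bar>"] zs(2) \<tau>
    by (simp add: dual_norm_scaleR[OF N] Liminf_const)
  also have "\<dots> \<le> ereal (1 + \<tau>)"
    using dual_norm_triangle[OF N, of "zs 0" "\<tau> *\<^sub>R zs _"] zs(2) \<tau>
    by (intro Liminf_le) (auto simp: dual_norm_scaleR[OF N])
  finally show ?thesis by simp
qed

text \<open>\<open>GREATEST\<close> carries information only once a maximum is known to exist. The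
  admissible constants are bounded by \<tau>, and their supremum is admissible because
  \<open>c\<close> enters only through a non-strict lower bound on a limit inferior.\<close>

lemma theta_is_greatest:
  fixes N :: "'a::real_normed_vector \<Rightarrow> real"
  assumes sep: "separable_infinite_dimensional TYPE('a)" and N: "equivalent_norm l N"
    and \<tau>: "0 \<le> \<tau>"
  shows "theta_bound N \<tau> (theta N \<tau>) \<and> (\<forall>c. theta_bound N \<tau> c \<longrightarrow> c \<le> theta N \<tau>)"
proof -
  let ?C = "{c. theta_bound N \<tau> c}"
  have bdd: "bdd_above ?C"
    using theta_bound_le[OF sep N \<tau>] by (intro bdd_aboveI[of _ \<tau>]) simp
  have up: "c \<le> Sup ?C" if "theta_bound N \<tau> c" for c
    using that bdd by (simp add: cSup_upper)
  define S where "S = Sup ?C"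
  have "theta_bound N \<tau> S"
    unfolding theta_bound_def
  proof (intro allI impI)
    fix z zs
    assume *: "dual_norm N z = 1 \<and> weak_star_null zs \<and>
      ereal \<tau> \<le> liminf (\<lambda>n. ereal (dual_norm N (zs n)))"
    let ?L = "liminf (\<lambda>n. ereal (dual_norm N (z + zs n)))"
    have "ereal (1 + S) \<le> ?L + ereal e" if e: "0 < e" for e
    proof -
      obtain c where c: "theta_bound N \<tau> c" "S - e < c"
        using less_cSup_iff[OF _ bdd, of "S - e"] theta_bound_0[OF N] e by (auto simp: S_def)
      have "ereal (1 + c) \<le> ?L"
        using c(1) * unfolding theta_bound_def by blast
      then have "ereal (1 + c) + ereal e \<le> ?L + ereal e"
        by (rule add_right_mono)
      moreover have "ereal (1 + S) \<le> ereal (1 + c) + ereal e" using c(2) by simp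
      ultimately show ?thesis by (rule order_trans[rotated])
    qed
    then show "ereal (1 + S) \<le> ?L" by (rule ereal_le_epsilon2)
  qed
  moreover from this have "theta N \<tau> = S"
    unfolding theta_eq by (rule Greatest_equality) (auto simp: S_def intro: up)
  ultimately show ?thesis using up by (simp add: S_def)
qed

lemma theta_bound_theta:
  fixes N :: "'a::real_normed_vector \<Rightarrow> real"
  assumes "separable_infinite_dimensional TYPE('a)" "equivalent_norm l N" "0 \<le> \<tau>"
  shows "theta_bound N \<tau> (theta N \<tau>)"
  using theta_is_greatest[OF assms] by blast

lemma theta_ge:
  fixes N :: "'a::real_normed_vector \<Rightarrow> real"
  assumes "separable_infinite_dimensional TYPE('a)" "equivalent_norm l N" "0 \<le> \<tau>"
    and "theta_bound N \<tau> c"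
  shows "c \<le> theta N \<tau>"
  using theta_is_greatest[OF assms(1-3)] assms(4) by blast

section \<open>Asymptotic smoothness\<close>

text \<open>Banach--Alaoglu in the form of the finite intersection property, obtained from Tychonoff's theorem in
  the space of all real functions. Nothing is assumed about the size of the family, because the dual of
  a separable space need not be separable.\<close>

lemma weak_star_cluster_point:
  fixes S :: "'i \<Rightarrow> ('a::real_normed_vector \<Rightarrow>\<^sub>L real) set"
  assumes ne: "\<And>i. i \<in> I \<Longrightarrow> S i \<noteq> {}" and ball: "\<And>i g. i \<in> I \<Longrightarrow> g \<in> S i \<Longrightarrow> norm g \<le> 1"
    and I: "I \<noteq> {}" and directed: "\<And>i j. i \<in> I \<Longrightarrow> j \<in> I \<Longrightarrow> \<exists>k\<in>I. S k \<subseteq> S i \<inter> S j"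
  shows "\<exists>g0. norm g0 \<le> 1 \<and> (\<forall>i\<in>I. \<forall>F e. finite F \<longrightarrow> 0 < e \<longrightarrow>
       (\<exists>g\<in>S i. \<forall>x\<in>F. \<bar>blinfun_apply g x - blinfun_apply g0 x\<bar> < e))"
proof -
  define T where "T i = closure (blinfun_apply ` S i)" for i
  define K where "K = Pi\<^sub>E UNIV (\<lambda>x::'a. cball (0::real) (norm x))"
  have "compactin (product_topology (\<lambda>_. euclidean) UNIV) K"
    unfolding K_def by (subst compactin_PiE) auto
  then have K: "compact K" by (simp add: euclidean_product_topology)
  have TK: "T i \<subseteq> K" if "i \<in> I" for i
    unfolding T_def
  proof (rule closure_minimal)
    show "blinfun_apply ` S i \<subseteq> K"
    proof
      fix f assume "f \<in> blinfun_apply ` S i"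
      then obtain g where g: "g \<in> S i" "f = blinfun_apply g" by auto
      have "\<bar>f x\<bar> \<le> norm x" for x
      proof -
        have "norm g * norm x \<le> norm x" using ball[OF that g(1)] by (simp add: mult_left_le_one_le)
        then show ?thesis using norm_blinfun[of g x] g(2) by simp
      qed
      then show "f \<in> K" by (auto simp: K_def PiE_iff)
    qed
    have "closedin (product_topology (\<lambda>_. euclidean) UNIV) K"
      unfolding K_def by (subst closedin_product_topology) auto
    then show "closed K" by (simp add: euclidean_product_topology)
  qed
  have fin: "\<exists>k\<in>I. S k \<subseteq> (\<Inter>i\<in>J. S i)" if "finite J" "J \<subseteq> I" for J
    using that
  proof induction
    case empty
    then show ?case using I by auto
  next
    case (insert i J)
    then obtain k where k: "k \<in> I" "S k \<subseteq> (\<Inter>i\<in>J. S i)" by auto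
    obtain m where "m \<in> I" "S m \<subseteq> S i \<inter> S k" using directed[of i k] insert k by auto
    then show ?case using k by auto
  qed
  have "K \<inter> \<Inter>(T ` I) \<noteq> {}"
  proof (rule compact_imp_fip[OF K])
    show "closed C" if "C \<in> T ` I" for C using that by (auto simp: T_def)
    fix F' assume F': "finite F'" "F' \<subseteq> T ` I"
    then obtain J where J: "finite J" "J \<subseteq> I" "F' = T ` J" by (meson finite_subset_image)
    obtain k where k: "k \<in> I" "S k \<subseteq> (\<Inter>i\<in>J. S i)" using fin[OF J(1,2)] by blast
    obtain g where g: "g \<in> S k" using ne[OF k(1)] by auto
    have "blinfun_apply g \<in> T i" if "i = k \<or> i \<in> J" for i
      unfolding T_def using that k g closure_subset by fastforce
    then show "K \<inter> \<Inter>F' \<noteq> {}" using TK[OF k(1)] J(3) by auto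
  qed
  then obtain h where h: "\<And>i. i \<in> I \<Longrightarrow> h \<in> T i" by auto
  have approx: "\<exists>g\<in>S i. \<forall>x\<in>F. \<bar>blinfun_apply g x - h x\<bar> < e"
    if i: "i \<in> I" and F: "finite F" and e: "0 < e" for i F e
  proof -
    let ?U = "{f. \<forall>x\<in>F. f x \<in> ball (h x) e}"
    have "open ?U"
      using product_topology_basis'[of F "\<lambda>x. ball (h x) e" "\<lambda>x. x"] F by simp
    moreover have "h \<in> closure (blinfun_apply ` S i)" using h[OF i] by (simp add: T_def)
    ultimately obtain f where "f \<in> blinfun_apply ` S i" "f \<in> ?U"
      using open_Int_closure_eq_empty[of ?U "blinfun_apply ` S i"] e by force
    then obtain g where "g \<in> S i" "\<forall>x\<in>F. dist (h x) (blinfun_apply g x) < e" by auto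
    then show ?thesis by (intro bexI[of _ g]) (auto simp: dist_real_def abs_minus_commute)
  qed
  obtain i0 where i0: "i0 \<in> I" using I by blast
  have bound: "norm (h x) \<le> norm x * 1" for x
  proof (rule field_le_epsilon)
    fix e :: real assume "0 < e"
    then obtain g where g: "g \<in> S i0" "\<bar>blinfun_apply g x - h x\<bar> < e"
      using approx[OF i0, of "{x}" e] by auto
    have "norm g * norm x \<le> norm x" using ball[OF i0 g(1)] by (simp add: mult_left_le_one_le)
    then show "norm (h x) \<le> norm x * 1 + e" using g(2) norm_blinfun[of g x] by simp
  qed
  \<comment> \<open>Linearity is a condition on finitely many coordinates, so it passes to
    \<open>h\<close> from one member of \<open>S i0\<close> that is close to \<open>h\<close> at
    just those points.\<close>
  have "h (x + y) = h x + h y" for x y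
  proof (rule ccontr)
    assume ne: "h (x + y) \<noteq> h x + h y"
    define e where "e = \<bar>h (x + y) - (h x + h y)\<bar> / 3"
    obtain g where "g \<in> S i0" "\<forall>v\<in>{x, y, x + y}. \<bar>blinfun_apply g v - h v\<bar> < e"
      using approx[OF i0, of "{x, y, x + y}" e] ne by (auto simp: e_def)
    then have "\<bar>blinfun_apply g x - h x\<bar> < e" "\<bar>blinfun_apply g y - h y\<bar> < e"
      "\<bar>blinfun_apply g x + blinfun_apply g y - h (x + y)\<bar> < e"
      by (auto simp: blinfun.add_right)
    then have "\<bar>h (x + y) - (h x + h y)\<bar> < 3 * e" by linarith
    then show False by (simp add: e_def)
  qed
  moreover have "h (r *\<^sub>R x) = r *\<^sub>R h x" for r x
  proof (rule ccontr)
    assume ne: "h (r *\<^sub>R x) \<noteq> r *\<^sub>R h x"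
    define e where "e = \<bar>h (r *\<^sub>R x) - r * h x\<bar> / (\<bar>r\<bar> + 1)"
    have e: "0 < e" using ne by (simp add: e_def)
    obtain g where "g \<in> S i0" "\<forall>v\<in>{x, r *\<^sub>R x}. \<bar>blinfun_apply g v - h v\<bar> < e"
      using approx[OF i0 _ e, of "{x, r *\<^sub>R x}"] by auto
    then have g: "\<bar>blinfun_apply g x - h x\<bar> < e" "\<bar>r * blinfun_apply g x - h (r *\<^sub>R x)\<bar> < e"
      by (auto simp: blinfun.scaleR_right)
    have "\<bar>h (r *\<^sub>R x) - r * h x\<bar>
        \<le> \<bar>r * blinfun_apply g x - h (r *\<^sub>R x)\<bar> + \<bar>r * (blinfun_apply g x - h x)\<bar>"
      by (simp add: algebra_simps)
    also have "\<dots> = \<bar>r * blinfun_apply g x - h (r *\<^sub>R x)\<bar> + \<bar>r\<bar> * \<bar>blinfun_apply g x - h x\<bar>"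
      by (simp add: abs_mult)
    also have "\<dots> < e + \<bar>r\<bar> * e"
      using g by (intro add_less_le_mono mult_left_mono) auto
    also have "\<dots> = (\<bar>r\<bar> + 1) * e" by (simp add: algebra_simps)
    also have "\<dots> = \<bar>h (r *\<^sub>R x) - r * h x\<bar>" by (simp add: e_def add_eq_0_iff)
    finally show False by simp
  qed
  ultimately have "bounded_linear h" by (intro bounded_linear_intro[OF _ _ bound])
  then have app: "blinfun_apply (Blinfun h) = h" by (rule bounded_linear_Blinfun_apply)
  have "norm (Blinfun h) \<le> 1"
    using bound by (intro norm_blinfun_bound) (auto simp: app)
  then show ?thesis using approx by (intro exI[of _ "Blinfun h"]) (simp add: app)
qed

text \<open>A failure would yield norming functionals \<open>g n\<close> of points \<open>u + z\<close>; with \<open>g0\<close> a weak* cluster point,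
  \<open>g0\<close> and \<open>g n - g0\<close>, suitably rescaled, violate the bound \<open>c\<close>. The neighbourhood is shrunk by \<open>g0\<close>
  itself, which makes \<open>g0 z\<close> negligible.\<close>

lemma asymptotic_smoothness_unit:
  fixes u :: "'a::real_normed_vector"
  assumes sep: "separable_infinite_dimensional TYPE('a)"
    and c: "theta_bound (norm :: 'a \<Rightarrow> real) t c" "0 < c" "c \<le> t" and \<delta>: "0 < \<delta>" and u: "norm u = 1"
  obtains J :: "('a \<Rightarrow>\<^sub>L real) set" and d where "finite J" "0 < d"
    "\<And>z. (\<forall>f\<in>J. \<bar>blinfun_apply f z\<bar> \<le> d) \<Longrightarrow> norm z \<le> c / t \<Longrightarrow> norm (u + z) \<le> 1 + c + \<delta>"
proof (rule ccontr)
  note outer = that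
  assume neg: "\<not> thesis"
  define Z where "Z J d z \<longleftrightarrow> (\<forall>f\<in>J. \<bar>blinfun_apply f z\<bar> \<le> d) \<and> norm z \<le> c / t"
    for J :: "('a \<Rightarrow>\<^sub>L real) set" and d z
  define S where "S = (\<lambda>(J, d). {g :: 'a \<Rightarrow>\<^sub>L real. norm g \<le> 1 \<and> (\<exists>z. Z J d z \<and> 1 + c + \<delta> < blinfun_apply g (u + z))})"
  define I where "I = {(J, d). finite (J :: ('a \<Rightarrow>\<^sub>L real) set) \<and> 0 < (d::real)}"
  have ne: "S i \<noteq> {}" if i: "i \<in> I" for i
  proof -
    obtain J d where Jd: "i = (J, d)" "finite J" "0 < d" using i by (auto simp: I_def)
    obtain z where z: "Z J d z" "1 + c + \<delta> < norm (u + z)"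
      using outer[OF Jd(2,3)] neg unfolding Z_def by (meson not_le)
    obtain g :: "'a \<Rightarrow>\<^sub>L real" where "norm g \<le> 1" "blinfun_apply g (u + z) = norm (u + z)"
      using norming_functional by blast
    then have "g \<in> S i" using z Jd(1) by (simp add: S_def) metis
    then show ?thesis by blast
  qed
  have ball: "norm g \<le> 1" if "i \<in> I" "g \<in> S i" for i g using that by (auto simp: S_def)
  have "({}, 1) \<in> I" by (simp add: I_def)
  then have I: "I \<noteq> {}" by blast
  have directed: "\<exists>k\<in>I. S k \<subseteq> S i \<inter> S j" if "i \<in> I" "j \<in> I" for i j
  proof -
    obtain J d J' d' where ij: "i = (J, d)" "j = (J', d')" by (metis surj_pair)
    have "(J \<union> J', min d d') \<in> I" using that ij by (auto simp: I_def)
    moreover have "S (J \<union> J', min d d') \<subseteq> S i \<inter> S j"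
      unfolding ij S_def Z_def by force
    ultimately show ?thesis by blast
  qed
  have "\<exists>g0. norm g0 \<le> 1 \<and> (\<forall>i\<in>I. \<forall>F e. finite F \<longrightarrow> 0 < e \<longrightarrow>
       (\<exists>g\<in>S i. \<forall>x\<in>F. \<bar>blinfun_apply g x - blinfun_apply g0 x\<bar> < e))"
    by (rule weak_star_cluster_point) (use ne ball I directed in \<open>blast+\<close>)
  then obtain g0 where g0: "norm g0 \<le> 1" and near:
    "\<And>i F e. i \<in> I \<Longrightarrow> finite F \<Longrightarrow> 0 < e \<Longrightarrow> \<exists>g\<in>S i. \<forall>x\<in>F. \<bar>blinfun_apply g x - blinfun_apply g0 x\<bar> < e"
    by blast
  obtain D :: "nat \<Rightarrow> 'a" where D: "\<And>x e. 0 < e \<Longrightarrow> \<exists>k. norm (x - D k) < e"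
    using dense_sequence[OF sep] by blast
  \<comment> \<open>All \<open>g n\<close> belong to the same neighbourhood, the one cut out by
    \<open>g0\<close>; with \<open>n\<close> only the agreement with \<open>g0\<close> improves, on
    \<open>u\<close> and on more of the dense sequence. Thus a sequence suffices, although the
    neighbourhoods form an uncountable family.\<close>
  have "\<exists>g. g \<in> S ({g0}, \<delta>/4) \<and>
      (\<forall>x\<in>insert u (D ` {..n}). \<bar>blinfun_apply g x - blinfun_apply g0 x\<bar> < min (\<delta>/4) (1 / Suc n))" for n
    using near[of "({g0}, \<delta>/4)" "insert u (D ` {..n})" "min (\<delta>/4) (1 / Suc n)"] \<delta>
    by (auto simp: I_def)
  then obtain g where g: "\<And>n. g n \<in> S ({g0}, \<delta>/4)"
    "\<And>n x. x \<in> insert u (D ` {..n}) \<Longrightarrow>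
      \<bar>blinfun_apply (g n) x - blinfun_apply g0 x\<bar> < min (\<delta>/4) (1 / Suc n)"
    by metis
  have g1: "norm (g n) \<le> 1" for n using g(1)[of n] by (simp add: S_def)
  have diff_bound: "norm (g n - g0) \<le> 2" for n
    using norm_triangle_ineq4[of "g n" g0] g1[of n] g0 by simp
  have null: "weak_star_null (\<lambda>n. g n - g0)"
  proof (rule weak_star_null_dense[OF D diff_bound])
    fix k
    show "(\<lambda>n. blinfun_apply (g n - g0) (D k)) \<longlonglongrightarrow> 0"
    proof (rule Lim_null_comparison[OF _ lim_inverse_n'[THEN LIMSEQ_Suc]])
      show "\<forall>\<^sub>F n in sequentially. norm (blinfun_apply (g n - g0) (D k)) \<le> 1 / real (Suc n)"
        using eventually_ge_at_top[of k]
      proof eventually_elim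
        case (elim n)
        then show ?case using g(2)[of "D k" n] by (simp add: blinfun.diff_left)
      qed
    qed
  qed
  define r where "r = norm g0"
  define w where "w n = norm (g n - g0)" for n
  have r: "0 \<le> r" "r \<le> 1" using g0 by (auto simp: r_def)
  have t: "0 < t" using c by simp
  \<comment> \<open>Expand \<open>g n (u + z)\<close> around \<open>g0\<close>: the value at
    \<open>u\<close> is at most \<open>r + \<delta>/4\<close> and \<open>g0 z\<close> at most
    \<open>\<delta>/4\<close>, so the rest of \<open>1 + c + \<delta>\<close> must come from
    \<open>(g n - g0) z\<close>, which the radius \<open>c / t\<close> limits.\<close>
  have w: "1 - r + c + \<delta>/2 < w n * (c / t)" for n
  proof -
    obtain z where z: "Z {g0} (\<delta>/4) z" "1 + c + \<delta> < blinfun_apply (g n) (u + z)"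
      using g(1)[of n] by (auto simp: S_def)
    have "blinfun_apply (g n - g0) z \<le> w n * norm z"
      using norm_blinfun[of "g n - g0" z] by (simp add: w_def)
    also have "\<dots> \<le> w n * (c / t)" using z(1) by (intro mult_left_mono) (auto simp: Z_def w_def)
    finally have "blinfun_apply (g n - g0) z \<le> w n * (c / t)" .
    moreover have "blinfun_apply g0 u \<le> r" using norm_blinfun[of g0 u] u by (simp add: r_def)
    moreover have "\<bar>blinfun_apply g0 z\<bar> \<le> \<delta>/4" using z(1) by (simp add: Z_def)
    moreover have "\<bar>blinfun_apply (g n) u - blinfun_apply g0 u\<bar> < \<delta>/4" using g(2)[of u n] by simp
    moreover have "1 + c + \<delta> < blinfun_apply (g n) u + blinfun_apply (g n) z"
      using z(2) by (simp only: blinfun.add_right)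
    ultimately show ?thesis unfolding blinfun.diff_left by linarith
  qed
  \<comment> \<open>If \<open>g0\<close> were 0, then \<open>w 0 \<le> 1\<close> and
    \<open>c \<le> t\<close> would bound the right side of \<open>w\<close> by 1.\<close>
  have "r \<noteq> 0"
  proof
    assume "r = 0"
    then have "g0 = 0" by (simp add: r_def)
    then have "w 0 \<le> 1" using g1[of 0] by (simp add: w_def)
    then have "w 0 * (c / t) \<le> 1 * 1" using c t by (intro mult_mono) auto
    then show False using w[of 0] \<open>r = 0\<close> c(2) \<delta> by linarith
  qed
  then have r0: "0 < r" using r by simp
  define B where "B = 1 - r + c + \<delta>/2"
  have B: "0 < B" "c < B" using r c \<delta> by (auto simp: B_def)
  have s_less: "t / w n < c / B" "0 < w n" for n
  proof -
    have "0 < w n * (c / t)" using w[of n] B by (simp add: B_def)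
    then show "0 < w n" using c t by (simp add: zero_less_mult_iff zero_less_divide_iff)
    then show "t / w n < c / B" using w[of n] B t by (simp add: B_def field_simps)
  qed
  \<comment> \<open>Rescaled to have norm exactly \<open>t\<close>. By \<open>w\<close> the factors
    are below \<open>c / B\<close>, so the sequence stays weak* null.\<close>
  define zs where "zs n = (t / w n) *\<^sub>R (g n - g0)" for n
  have "\<bar>t / w n\<bar> \<le> c / B" for n using s_less[of n] t by (simp add: less_imp_le)
  then have "weak_star_null zs" unfolding zs_def by (rule weak_star_null_scaleR[OF null])
  moreover have "ereal t \<le> liminf (\<lambda>n. ereal (norm (zs n)))"
  proof -
    have "norm (zs n) = t" for n using s_less(2)[of n] t by (simp add: zs_def w_def)
    then show ?thesis by (simp add: Liminf_const)
  qed
  moreover have "norm ((1/r) *\<^sub>R g0) = 1" using \<open>r \<noteq> 0\<close> by (simp add: r_def)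
  ultimately have lim: "ereal (1 + c) \<le> liminf (\<lambda>n. ereal (norm ((1/r) *\<^sub>R g0 + zs n)))"
    using c(1) unfolding theta_bound_def dual_norm_norm by blast
  \<comment> \<open>Smaller than \<open>c\<close> because \<open>B\<close> exceeds
    \<open>1 - r\<close>.\<close>
  define q where "q = (c / B) * (1 - r)"
  have q: "q < c"
    using B c \<delta> r by (simp add: q_def B_def field_simps) (simp add: add_pos_nonneg)
  \<comment> \<open>With \<open>s = t / w n\<close> the vector is
    \<open>(1/r - s) *\<^sub>R g0 + s *\<^sub>R g n\<close> with nonnegative coefficients, and both
    functionals have known bounds: \<open>r\<close> for \<open>g0\<close> and 1 for
    \<open>g n\<close>. This gives \<open>1 + s * (1 - r)\<close>.\<close>
  have "norm ((1/r) *\<^sub>R g0 + zs n) \<le> 1 + q" for n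
  proof -
    define s where "s = t / w n"
    have s: "0 \<le> s" "s \<le> c / B" using s_less[of n] t by (auto simp: s_def)
    have "c / B \<le> 1" using B c by simp
    then have s1: "s \<le> 1 / r" using s r r0 by (simp add: field_simps) (smt (verit) mult_le_one)
    have "(1/r) *\<^sub>R g0 + zs n = (1/r - s) *\<^sub>R g0 + s *\<^sub>R g n"
      by (simp add: zs_def s_def algebra_simps)
    then have "norm ((1/r) *\<^sub>R g0 + zs n) \<le> norm ((1/r - s) *\<^sub>R g0) + norm (s *\<^sub>R g n)"
      using norm_triangle_ineq by metis
    also have "\<dots> = (1/r - s) * r + s * norm (g n)" using s s1 by (simp add: r_def)
    also have "\<dots> \<le> (1/r - s) * r + s * 1" using g1[of n] s by (intro add_left_mono mult_left_mono) auto
    also have "\<dots> = 1 + s * (1 - r)" using r0 by (simp add: algebra_simps)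
    also have "\<dots> \<le> 1 + q" unfolding q_def using s r by (intro add_left_mono mult_right_mono) auto
    finally show ?thesis .
  qed
  then have "liminf (\<lambda>n. ereal (norm ((1/r) *\<^sub>R g0 + zs n))) \<le> ereal (1 + q)"
    by (intro Liminf_le) auto
  then have "ereal (1 + c) \<le> ereal (1 + q)" using lim by (rule order_trans[rotated])
  then show False using q by simp
qed

lemma asymptotic_smoothness:
  fixes u :: "'a::real_normed_vector"
  assumes sep: "separable_infinite_dimensional TYPE('a)"
    and c: "theta_bound (norm :: 'a \<Rightarrow> real) t c" "0 < c" "c \<le> t" and \<delta>: "0 < \<delta>" and u: "u \<noteq> 0"
  obtains J :: "('a \<Rightarrow>\<^sub>L real) set" and d where "finite J" "0 < d"
    "\<And>z. (\<forall>f\<in>J. \<bar>blinfun_apply f z\<bar> \<le> d) \<Longrightarrow> norm z \<le> c / t * norm u \<Longrightarrow>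
      norm (u + z) \<le> (1 + c + \<delta>) * norm u"
proof -
  let ?v = "(1 / norm u) *\<^sub>R u"
  have "norm ?v = 1" using u by simp
  then obtain J :: "('a \<Rightarrow>\<^sub>L real) set" and d where J: "finite J" "0 < d"
    "\<And>z. (\<forall>f\<in>J. \<bar>blinfun_apply f z\<bar> \<le> d) \<Longrightarrow> norm z \<le> c / t \<Longrightarrow> norm (?v + z) \<le> 1 + c + \<delta>"
    using asymptotic_smoothness_unit[OF sep c \<delta>] by blast
  have "norm (u + z) \<le> (1 + c + \<delta>) * norm u"
    if z: "\<forall>f\<in>J. \<bar>blinfun_apply f z\<bar> \<le> d * norm u" "norm z \<le> c / t * norm u" for z
  proof -
    have "norm (?v + (1 / norm u) *\<^sub>R z) \<le> 1 + c + \<delta>"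
      using z u by (intro J(3)) (auto simp: blinfun.scaleR_right abs_mult pos_divide_le_eq)
    moreover have "u + z = norm u *\<^sub>R (?v + (1 / norm u) *\<^sub>R z)"
      using u by (simp add: scaleR_add_right)
    ultimately show ?thesis by (metis abs_norm_cancel mult.commute mult_left_mono norm_ge_zero norm_scaleR)
  qed
  then show ?thesis using that[of J "d * norm u"] J u by simp
qed

section \<open>Approximate fixed points\<close>

text \<open>Brouwer's theorem on a grid of mesh \<open>1 / p\<close>, from Kuhn's labelling lemma.
  The approximate fixed point is itself a grid point, so maps with a common modulus of continuity
  share one finite set of candidates. This is how a finite set independent of \<open>y\<close>
  arises in \<open>weak_Gorelik\<close>.\<close>

lemma approximate_fixed_point_cube:
  fixes T :: "(nat \<Rightarrow> real) \<Rightarrow> nat \<Rightarrow> real"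
  assumes p: "0 < p"
    and range: "\<And>t i. (\<And>j. j < n \<Longrightarrow> 0 \<le> t j \<and> t j \<le> 1) \<Longrightarrow> i < n \<Longrightarrow> 0 \<le> T t i \<and> T t i \<le> 1"
    and cont: "\<And>t s i. (\<And>j. j < n \<Longrightarrow> \<bar>t j - s j\<bar> \<le> 1 / real p) \<Longrightarrow> i < n \<Longrightarrow> \<bar>T t i - T s i\<bar> \<le> \<eta>"
  obtains q where "\<And>i. i < n \<Longrightarrow> q i < p"
    "\<And>i. i < n \<Longrightarrow> \<bar>T (\<lambda>i. real (q i) / real p) i - real (q i) / real p\<bar> \<le> \<eta> + 1 / real p"
proof -
  define pt where "pt q = (\<lambda>i::nat. real (q i) / real p)" for q :: "nat \<Rightarrow> nat"
  \<comment> \<open>Label 1 means that \<open>T\<close> lowers coordinate \<open>i\<close>. It is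
    imposed on the far face \<open>x i = p\<close>, as Kuhn's lemma demands; there
    \<open>T \<le> 1\<close> gives at least the weak inequality.\<close>
  define label where "label x i = (if x i = p \<or> T (pt x) i < pt x i then 1 else 0 :: nat)" for x i
  have T01: "0 \<le> T (pt x) i \<and> T (pt x) i \<le> 1" if "\<forall>i<n. x i \<le> p" "i < n" for x i
    using that p by (intro range) (auto simp: pt_def)
  have label0: "\<forall>x. (\<forall>i<n. x i \<le> p) \<longrightarrow> (\<forall>i<n. x i = 0 \<longrightarrow> label x i = 0)"
  proof (intro allI impI)
    fix x i assume "\<forall>i<n. x i \<le> p" "i < n" "x i = 0"
    then show "label x i = 0" using T01[of x i] p by (auto simp: label_def pt_def)
  qed
  obtain q where q: "\<forall>i<n. q i < p"
    "\<forall>i<n. \<exists>r s. (\<forall>j<n. q j \<le> r j \<and> r j \<le> q j + 1) \<and>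
       (\<forall>j<n. q j \<le> s j \<and> s j \<le> q j + 1) \<and> label r i \<noteq> label s i"
    by (rule kuhn_lemma[of p n label]) (use p label0 in \<open>auto simp: label_def\<close>)
  have "\<bar>T (pt q) i - pt q i\<bar> \<le> \<eta> + 1 / real p" if i: "i < n" for i
  proof -
    have near: "\<bar>T (pt q) i - T (pt r) i\<bar> \<le> \<eta> \<and> pt q i \<le> pt r i \<and> pt r i \<le> pt q i + 1 / real p"
      if r: "\<forall>j<n. q j \<le> r j \<and> r j \<le> q j + 1" for r
    proof -
      have "pt q j \<le> pt r j \<and> pt r j \<le> pt q j + 1 / real p" if "j < n" for j
      proof -
        have "q j \<le> r j \<and> r j \<le> q j + 1" using r that by blast
        then have "real (q j) \<le> real (r j) \<and> real (r j) \<le> real (q j) + 1" by linarith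
        then show ?thesis using p by (simp add: pt_def divide_simps)
      qed
      moreover from this have "\<bar>pt q j - pt r j\<bar> \<le> 1 / real p" if "j < n" for j
        using that by force
      then have "\<bar>T (pt q) i - T (pt r) i\<bar> \<le> \<eta>"
        using i by (intro cont) auto
      ultimately show ?thesis using i by blast
    qed
    \<comment> \<open>Both labels occur next to \<open>q\<close>, so \<open>T\<close> does not lower
      coordinate \<open>i\<close> at \<open>r\<close> and does not raise it at \<open>s\<close>.
      Comparing both with \<open>q\<close> costs \<eta> and one mesh width.\<close>
    obtain r s where rs: "\<forall>j<n. q j \<le> r j \<and> r j \<le> q j + 1" "\<forall>j<n. q j \<le> s j \<and> s j \<le> q j + 1"
      "label r i = 0" "label s i = 1"
      using q(2) i by (metis label_def)
    have "pt r i \<le> T (pt r) i" using rs(3) by (auto simp: label_def split: if_splits)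
    moreover have "T (pt s) i \<le> pt s i"
    proof (cases "s i = p")
      case True
      have "\<forall>j<n. s j \<le> p" using rs(2) q(1) by (metis Suc_eq_plus1 Suc_leI order_trans)
      then have "T (pt s) i \<le> 1" using T01 i by blast
      then show ?thesis using True p by (simp add: pt_def)
    qed (use rs(4) in \<open>auto simp: label_def split: if_splits\<close>)
    ultimately show ?thesis using near[OF rs(1)] near[OF rs(2)] by linarith
  qed
  then show ?thesis using that[of q] q(1) by (simp add: pt_def)
qed

section \<open>Fixed points and small images in a weak neighbourhood of 0\<close>

lemma abs_blinfun:
  fixes f :: "'a::real_normed_vector \<Rightarrow>\<^sub>L real"
  shows "\<bar>blinfun_apply f x\<bar> \<le> norm f * norm x"
  using norm_blinfun[of f x] by simp

text \<open>Rounding the values \<open>f w / \<delta>\<close> for \<open>f \<in> J\<close> to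
  integers sends the ball to a finite set; one representative per class is a net.\<close>

lemma weak_totally_bounded:
  fixes J :: "('a::real_normed_vector \<Rightarrow>\<^sub>L real) set"
  assumes J: "finite J" and \<delta>: "0 < \<delta>"
  obtains F where "finite F" "F \<subseteq> cball 0 c"
    "\<And>w. w \<in> cball 0 c \<Longrightarrow> \<exists>x\<in>F. \<forall>f\<in>J. \<bar>blinfun_apply f (w - x)\<bar> < \<delta>"
proof -
  let ?B = "cball (0::'a) c"
  define \<phi> where "\<phi> w = restrict (\<lambda>f. \<lfloor>blinfun_apply f w / \<delta>\<rfloor>) J" for w
  have floor_bound: "\<lfloor>- (norm f * c / \<delta>)\<rfloor> \<le> \<lfloor>blinfun_apply f w / \<delta>\<rfloor> \<and>
        \<lfloor>blinfun_apply f w / \<delta>\<rfloor> \<le> \<lfloor>norm f * c / \<delta>\<rfloor>"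
    if w: "norm w \<le> c" for w :: 'a and f :: "'a \<Rightarrow>\<^sub>L real"
  proof -
    have "\<bar>blinfun_apply f w\<bar> \<le> norm f * c"
      using norm_blinfun[of f w] mult_left_mono[OF w norm_ge_zero[of f]] by simp
    then have "- (norm f * c / \<delta>) \<le> blinfun_apply f w / \<delta>" "blinfun_apply f w / \<delta> \<le> norm f * c / \<delta>"
      using \<delta> by (auto simp: abs_le_iff field_simps)
    then show ?thesis by (simp add: floor_mono)
  qed
  have "\<phi> ` ?B \<subseteq> Pi\<^sub>E J (\<lambda>f. {\<lfloor>- (norm f * c / \<delta>)\<rfloor>..\<lfloor>norm f * c / \<delta>\<rfloor>})"
  proof
    fix k assume "k \<in> \<phi> ` ?B"
    then obtain w where w: "norm w \<le> c" "k = \<phi> w" by auto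
    then show "k \<in> Pi\<^sub>E J (\<lambda>f. {\<lfloor>- (norm f * c / \<delta>)\<rfloor>..\<lfloor>norm f * c / \<delta>\<rfloor>})"
      using floor_bound[OF w(1)] by (auto simp: \<phi>_def)
  qed
  then have "finite (\<phi> ` ?B)" by (rule finite_subset) (use J in \<open>auto intro: finite_PiE\<close>)
  then obtain F where F: "F \<subseteq> ?B" "finite F" "\<phi> ` ?B = \<phi> ` F"
    by (meson finite_subset_image subset_refl)
  have "\<exists>x\<in>F. \<forall>f\<in>J. \<bar>blinfun_apply f (w - x)\<bar> < \<delta>" if "w \<in> ?B" for w
  proof -
    have "\<phi> w \<in> \<phi> ` F" using F(3) that by blast
    then obtain x where x: "x \<in> F" "\<phi> w = \<phi> x" by auto
    have "\<bar>blinfun_apply f (w - x)\<bar> < \<delta>" if "f \<in> J" for f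
    proof -
      have "\<lfloor>blinfun_apply f w / \<delta>\<rfloor> = \<lfloor>blinfun_apply f x / \<delta>\<rfloor>"
        using fun_cong[OF x(2), of f] that by (simp add: \<phi>_def)
      then have "\<bar>blinfun_apply f w / \<delta> - blinfun_apply f x / \<delta>\<bar> < 1" by linarith
      then have "\<bar>blinfun_apply f (w - x) / \<delta>\<bar> < 1"
        by (simp add: blinfun.diff_right diff_divide_distrib)
      then show ?thesis using \<delta> by simp
    qed
    then show ?thesis using x(1) by blast
  qed
  then show ?thesis using that F by blast
qed

text \<open>The combinatorial core of the Gorelik principle. The finite-codimensional subspace is replaced by
  a weak neighbourhood of \<open>0\<close>, so that finite sets \<open>A\<close> suffice: the barycentric coordinates of
  \<open>x - \<Phi> y x\<close> with respect to a finite net define a self-map of a cube, which is fed into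
  \<open>approximate_fixed_point_cube\<close>.\<close>

lemma weak_Gorelik:
  fixes \<Phi> :: "'i \<Rightarrow> 'a::real_normed_vector \<Rightarrow> 'a" and J :: "('a \<Rightarrow>\<^sub>L real) set"
  assumes J: "finite J" and d: "0 < d" and c: "0 < c"
    and disp: "\<And>y x. y \<in> B \<Longrightarrow> norm (x - \<Phi> y x) \<le> c"
    and equi: "\<And>e. 0 < e \<Longrightarrow> \<exists>h>0. \<forall>y\<in>B. \<forall>x x'. norm (x - x') < h \<longrightarrow> norm (\<Phi> y x - \<Phi> y x') < e"
  obtains A where "finite A"
    "\<And>y. y \<in> B \<Longrightarrow> \<exists>x\<in>A. norm (\<Phi> y x) \<le> 2 * c + d \<and> (\<forall>f\<in>J. \<bar>blinfun_apply f (\<Phi> y x)\<bar> \<le> d)"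
proof -
  define L where "L = (\<Sum>f\<in>J. norm f) + 1"
  define \<mu> where "\<mu> v = (\<Sum>f\<in>J. \<bar>blinfun_apply f v\<bar>)" for v
  define d1 where "d1 = d / 4"
  have L: "1 \<le> L" by (simp add: L_def sum_nonneg)
  have d1: "0 < d1" using d by (simp add: d1_def)
  have \<mu>_minus: "\<mu> (v - w) = \<mu> (w - v)" for v w
    by (simp add: \<mu>_def blinfun.diff_right abs_minus_commute)
  have \<mu>_bound: "\<mu> v \<le> L * norm v" for v
  proof -
    have "\<mu> v \<le> (\<Sum>f\<in>J. norm f * norm v)"
      unfolding \<mu>_def by (intro sum_mono abs_blinfun)
    also have "\<dots> = (\<Sum>f\<in>J. norm f) * norm v" by (simp add: sum_distrib_right)
    also have "\<dots> \<le> L * norm v" unfolding L_def by (intro mult_right_mono) auto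
    finally show ?thesis .
  qed
  have \<mu>_add: "\<mu> (v + w) \<le> \<mu> v + \<mu> w" for v w
    unfolding \<mu>_def sum.distrib[symmetric] by (intro sum_mono) (simp add: blinfun.add_right)
  have \<mu>_diff: "\<mu> v \<le> \<mu> w + L * norm (v - w)" for v w
    using \<mu>_add[of w "v - w"] \<mu>_bound[of "v - w"] by simp
  obtain F where F: "finite F" "F \<subseteq> cball 0 c" and net:
    "\<And>w. w \<in> cball 0 c \<Longrightarrow> \<exists>x\<in>F. \<forall>f\<in>J. \<bar>blinfun_apply f (w - x)\<bar> < d1 / (card J + 1)"
    using weak_totally_bounded[OF J, of "d1 / (card J + 1)" c] d1 by auto
  have net\<mu>: "\<exists>x\<in>F. \<mu> (w - x) \<le> d1" if w: "norm w \<le> c" for w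
  proof -
    obtain x where x: "x \<in> F" "\<forall>f\<in>J. \<bar>blinfun_apply f (w - x)\<bar> < d1 / (card J + 1)"
      using net[of w] w by auto
    have "\<mu> (w - x) \<le> (\<Sum>f\<in>J. d1 / (card J + 1))"
      unfolding \<mu>_def using x(2) by (intro sum_mono) (simp add: less_imp_le)
    also have "\<dots> \<le> d1" using d1 by (simp add: divide_le_eq algebra_simps)
    finally show ?thesis using x(1) by blast
  qed
  define N where "N = card F"
  have "F \<noteq> {}" using net[of 0] c by auto
  then have N: "1 \<le> real N" using F(1) by (simp add: N_def Suc_leI card_gt_0_iff)
  obtain x where x: "bij_betw x {..<N} F"
    using ex_bij_betw_nat_finite[OF F(1)] by (auto simp: N_def lessThan_atLeast0)
  have xc: "norm (x i) \<le> c" if "i < N" for i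
    using bij_betwE[OF x] that F(2) by auto
  \<comment> \<open>Weights of a partition of unity before normalization. They vanish at
    \<open>\<mu>\<close>-distance \<open>2 * d1\<close> or more from \<open>x i\<close>, while the
    net makes one of them at least \<open>d1\<close>, so \<open>P\<close> can be divided by without
    losing Lipschitz control.\<close>
  define p where "p i w = max 0 (2 * d1 - \<mu> (w - x i))" for i w
  define P where "P w = (\<Sum>i<N. p i w)" for w
  have p0: "0 \<le> p i w" for i w by (simp add: p_def)
  have pP: "p i w \<le> P w" if "i < N" for i w
    unfolding P_def using that p0 by (intro member_le_sum) auto
  have P: "d1 \<le> P w" if w: "norm w \<le> c" for w
  proof -
    obtain i where i: "i < N" "\<mu> (w - x i) \<le> d1"
      using net\<mu>[OF w] x by (metis bij_betw_imp_surj_on imageE lessThan_iff)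
    then have "d1 \<le> p i w" by (simp add: p_def)
    then show ?thesis using pP[OF i(1), of w] by simp
  qed
  have p_lip: "\<bar>p i w - p i w'\<bar> \<le> L * norm (w - w')" for i w w'
  proof -
    have "\<bar>\<mu> (w - x i) - \<mu> (w' - x i)\<bar> \<le> L * norm (w - w')"
      using \<mu>_diff[of "w - x i" "w' - x i"] \<mu>_diff[of "w' - x i" "w - x i"]
      by (simp add: norm_minus_commute abs_le_iff)
    then show ?thesis unfolding p_def by linarith
  qed
  have P_lip: "\<bar>P w - P w'\<bar> \<le> N * (L * norm (w - w'))" for w w'
  proof -
    have "\<bar>P w - P w'\<bar> \<le> (\<Sum>i<N. \<bar>p i w - p i w'\<bar>)"
      unfolding P_def sum_subtractf[symmetric] by (rule sum_abs)
    also have "\<dots> \<le> (\<Sum>i<N. L * norm (w - w'))" by (intro sum_mono p_lip)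
    finally show ?thesis by simp
  qed
  have quot_lip: "\<bar>p i w / P w - p i w' / P w'\<bar> \<le> (N + 1) * L * norm (w - w') / d1"
    if i: "i < N" and w: "norm w \<le> c" "norm w' \<le> c" for i w w'
  proof -
    have pos: "0 < P w" "0 < P w'" "d1 \<le> P w" using P[OF w(1)] P[OF w(2)] d1 by auto
    have "\<bar>p i w / P w - p i w' / P w'\<bar>
        = \<bar>(p i w - p i w') / P w + (p i w' / P w') * ((P w' - P w) / P w)\<bar>"
      using pos by (simp add: field_simps)
    also have "\<dots> \<le> \<bar>p i w - p i w'\<bar> / P w + (p i w' / P w') * (\<bar>P w' - P w\<bar> / P w)"
      using pos p0[of i w'] by (intro order_trans[OF abs_triangle_ineq]) (simp add: abs_mult)
    also have "\<dots> \<le> \<bar>p i w - p i w'\<bar> / P w + 1 * (\<bar>P w' - P w\<bar> / P w)"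
      using pos pP[OF i, of w'] by (intro add_left_mono mult_right_mono) auto
    also have "\<dots> = (\<bar>p i w - p i w'\<bar> + \<bar>P w' - P w\<bar>) / P w" by (simp add: add_divide_distrib)
    also have "\<dots> \<le> ((N + 1) * L * norm (w - w')) / d1"
      using pos d1 p_lip[of i w w'] P_lip[of w' w]
      by (intro frac_le) (auto simp: algebra_simps norm_minus_commute)
    finally show ?thesis .
  qed
  define pos where "pos t = (\<Sum>i<N. t i *\<^sub>R x i)" for t :: "nat \<Rightarrow> real"
  have pos_diff: "norm (pos t - pos s) \<le> N * (\<epsilon> * c)"
    if "\<And>i. i < N \<Longrightarrow> \<bar>t i - s i\<bar> \<le> \<epsilon>" for t s \<epsilon>
  proof -
    have "norm (pos t - pos s) \<le> (\<Sum>i<N. norm ((t i - s i) *\<^sub>R x i))"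
      unfolding pos_def sum_subtractf[symmetric] scaleR_diff_left[symmetric] by (rule norm_sum)
    also have "\<dots> \<le> (\<Sum>i<N. \<epsilon> * c)"
    proof (rule sum_mono)
      fix i assume "i \<in> {..<N}"
      then have "\<bar>t i - s i\<bar> \<le> \<epsilon>" "norm (x i) \<le> c" using that xc by auto
      then show "norm ((t i - s i) *\<^sub>R x i) \<le> \<epsilon> * c"
        using mult_mono[of "\<bar>t i - s i\<bar>" \<epsilon> "norm (x i)" c] by simp
    qed
    finally show ?thesis by simp
  qed
  define W where "W y t = pos t - \<Phi> y (pos t)" for y t
  have Wc: "norm (W y t) \<le> c" if "y \<in> B" for y t
    using disp[OF that] by (simp add: W_def)
  \<comment> \<open>At a fixed point \<open>t\<close>, \<open>pos t\<close> would be a convex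
    combination of net points \<open>\<mu>\<close>-close to
    \<open>W y t = pos t - \<Phi> y (pos t)\<close>, so \<open>\<Phi> y (pos t)\<close> would be
    \<open>\<mu>\<close>-small.\<close>
  define T where "T y t i = p i (W y t) / P (W y t)" for y t i
  \<comment> \<open>A coordinate error of \<open>2 * \<eta>\<close> moves \<open>pos\<close> by at
    most \<open>d / (2 * L)\<close>, that is, by \<open>d / 2\<close> for \<mu>. The other half of
    \<open>d\<close> is the width \<open>2 * d1\<close> of the weights. Next, \<open>e0\<close> is
    the motion of \<open>W\<close> that changes a normalized weight by at most \<eta>.\<close>
  define \<eta> where "\<eta> = d / (4 * N * c * L)"
  have \<eta>: "0 < \<eta>" using d N c L by (simp add: \<eta>_def)
  define e0 where "e0 = \<eta> * d1 / ((N + 1) * L)"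
  have e0: "0 < e0" using \<eta> d1 L by (simp add: e0_def add_pos_nonneg)
  obtain h where h: "0 < h" "\<And>y x x'. y \<in> B \<Longrightarrow> norm (x - x') < h \<Longrightarrow> norm (\<Phi> y x - \<Phi> y x') < e0 / 2"
    using equi[of "e0/2"] e0 by auto
  \<comment> \<open>\<open>W\<close> moves with \<open>pos t\<close> and with its image under
    \<open>\<Phi> y\<close>; each is allowed half of \<open>e0\<close>.\<close>
  define g where "g = min h (e0 / 2)"
  have g: "0 < g" using h(1) e0 by (simp add: g_def)
  obtain m :: nat where m: "1 / \<eta> + N * c / g < m" using reals_Archimedean2 by blast
  have "0 < 1 / \<eta>" "0 \<le> N * c / g" using \<eta> g c by auto
  then have "0 < real m" "1 / \<eta> < m" "N * c / g < m" using m by linarith+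
  then have m': "0 < m" "1 / m \<le> \<eta>" "N * (1 / m * c) < g"
    using \<eta> g by (auto simp: field_simps)
  define A where "A = pos ` ((\<lambda>q i. real (q i) / real m) ` (Pi\<^sub>E {..<N} (\<lambda>_. {..<m})))"
  have "finite A" unfolding A_def by (intro finite_imageI finite_PiE) auto
  moreover have "\<exists>x\<in>A. norm (\<Phi> y x) \<le> 2 * c + d \<and> (\<forall>f\<in>J. \<bar>blinfun_apply f (\<Phi> y x)\<bar> \<le> d)"
    if y: "y \<in> B" for y
  proof -
    have T01: "0 \<le> T y t i \<and> T y t i \<le> 1" if "i < N" for t i
      using P[OF Wc[OF y]] p0 pP[OF that, of "W y t"] d1 unfolding T_def
      by (metis divide_le_eq_1_pos divide_nonneg_pos order_less_le_trans)
    have T_cont: "\<bar>T y t i - T y s i\<bar> \<le> \<eta>"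
      if ts: "\<And>j. j < N \<Longrightarrow> \<bar>t j - s j\<bar> \<le> 1 / real m" and i: "i < N" for t s i
    proof -
      have close: "norm (pos t - pos s) < g" using pos_diff[of t s "1 / m"] ts m'(3) by auto
      have "norm (W y t - W y s) \<le> norm (pos t - pos s) + norm (\<Phi> y (pos t) - \<Phi> y (pos s))"
        using norm_triangle_ineq4[of "pos t - pos s" "\<Phi> y (pos t) - \<Phi> y (pos s)"]
        by (simp add: W_def algebra_simps)
      also have "\<dots> \<le> e0" using close h(2)[OF y, of "pos t" "pos s"] by (simp add: g_def)
      finally have *: "norm (W y t - W y s) \<le> e0" .
      have "\<bar>T y t i - T y s i\<bar> \<le> (N + 1) * L * norm (W y t - W y s) / d1"
        unfolding T_def using quot_lip[OF i] Wc[OF y] by blast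
      also have "\<dots> \<le> (N + 1) * L * e0 / d1"
        using * L d1 by (intro divide_right_mono mult_left_mono) auto
      also have "\<dots> = \<eta>" using L d1 N by (simp add: e0_def)
      finally show ?thesis .
    qed
    obtain q where q: "\<And>i. i < N \<Longrightarrow> q i < m"
      "\<And>i. i < N \<Longrightarrow> \<bar>T y (\<lambda>i. real (q i) / real m) i - real (q i) / real m\<bar> \<le> \<eta> + 1 / real m"
      using approximate_fixed_point_cube[of m N "T y" \<eta>] m'(1) T01 T_cont by metis
    define t where "t = (\<lambda>i. real (q i) / real m)"
    define w where "w = W y t"
    define r where "r = T y t"
    have w: "norm w \<le> c" using Wc[OF y] by (simp add: w_def)
    have r0: "0 \<le> r i" if "i < N" for i using T01[OF that] by (simp add: r_def)
    have "(\<Sum>i<N. r i) = (\<Sum>i<N. p i w) / P w"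
      by (simp add: r_def T_def w_def sum_divide_distrib)
    also have "(\<Sum>i<N. p i w) = P w" by (simp add: P_def)
    finally have "(\<Sum>i<N. r i) = P w / P w" .
    then have r1: "(\<Sum>i<N. r i) = 1" using P[OF w] d1 by simp
    have "pos t = pos (\<lambda>i. real (restrict q {..<N} i) / real m)"
      unfolding pos_def t_def by (intro sum.cong) auto
    moreover have "restrict q {..<N} \<in> Pi\<^sub>E {..<N} (\<lambda>_. {..<m})" using q(1) by auto
    ultimately have tA: "pos t \<in> A" unfolding A_def by blast
    have "\<bar>t i - r i\<bar> \<le> 2 * \<eta>" if "i < N" for i
      using q(2)[OF that] m'(2) by (simp add: t_def r_def abs_minus_commute)
    then have "norm (pos t - pos r) \<le> N * (2 * \<eta> * c)" by (rule pos_diff)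
    also have "\<dots> = d / (2 * L)" using N c L by (simp add: \<eta>_def field_simps)
    finally have near: "norm (pos t - pos r) \<le> d / (2 * L)" .
    have "d / (2 * L) \<le> d" using L d by (simp add: field_simps)
    moreover have "norm (pos r) \<le> c"
    proof -
      have "norm (pos r) \<le> (\<Sum>i<N. r i * c)"
        unfolding pos_def using r0 xc
        by (intro order_trans[OF norm_sum] sum_mono) (auto intro!: mult_left_mono)
      also have "\<dots> = c" using r1 by (simp flip: sum_distrib_right)
      finally show ?thesis .
    qed
    ultimately have "norm (pos t) \<le> c + d"
      using near norm_triangle_sub[of "pos t" "pos r"] by linarith
    then have bound: "norm (\<Phi> y (pos t)) \<le> 2 * c + d"
      using w norm_triangle_ineq4[of "pos t" w] by (simp add: w_def W_def)
    \<comment> \<open>The coefficients \<open>r i\<close> sum to 1, so this is an average of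
      \<open>x i - w\<close>; a net point with nonzero coefficient has nonzero weight and hence lies
      within \<open>2 * d1\<close> of \<open>w\<close>.\<close>
    have "\<mu> (pos r - w) \<le> 2 * d1"
    proof -
      have "pos r - w = pos r - (\<Sum>i<N. r i) *\<^sub>R w" using r1 by simp
      also have "\<dots> = (\<Sum>i<N. r i *\<^sub>R (x i - w))"
        by (simp add: pos_def scaleR_sum_left sum_subtractf scaleR_diff_right)
      finally have "\<mu> (pos r - w) \<le> (\<Sum>f\<in>J. \<Sum>i<N. r i * \<bar>blinfun_apply f (x i - w)\<bar>)"
        unfolding \<mu>_def using r0
        by (auto intro!: sum_mono order_trans[OF sum_abs]
            simp: blinfun.sum_right blinfun.scaleR_right abs_mult)
      also have "\<dots> = (\<Sum>i<N. r i * \<mu> (x i - w))"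
        unfolding \<mu>_def sum_distrib_left by (rule sum.swap)
      also have "\<dots> \<le> (\<Sum>i<N. r i * (2 * d1))"
      proof (rule sum_mono)
        fix i assume "i \<in> {..<N}"
        show "r i * \<mu> (x i - w) \<le> r i * (2 * d1)"
        proof (cases "r i = 0")
          case False
          then have "p i w \<noteq> 0" by (auto simp: r_def T_def w_def)
          then have "\<mu> (x i - w) \<le> 2 * d1" by (auto simp: p_def \<mu>_minus max_def split: if_splits)
          then show ?thesis using r0[of i] \<open>i \<in> {..<N}\<close> by (intro mult_left_mono) auto
        qed simp
      qed
      also have "\<dots> = 2 * d1" using r1 by (simp flip: sum_distrib_right)
      finally show ?thesis .
    qed
    moreover have "L * norm (pos t - pos r) \<le> L * (d / (2 * L))" using near L by (intro mult_left_mono) auto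
    moreover have "\<mu> (pos t - w) \<le> \<mu> (pos r - w) + L * norm (pos t - pos r)"
      using \<mu>_diff[of "pos t - w" "pos r - w"] by simp
    ultimately have "\<mu> (\<Phi> y (pos t)) \<le> d"
      using L by (simp add: w_def W_def d1_def)
    moreover have "\<bar>blinfun_apply f v\<bar> \<le> \<mu> v" if "f \<in> J" for f v
      unfolding \<mu>_def using that J by (intro member_le_sum) auto
    ultimately show ?thesis using tA bound by (meson order_trans)
  qed
  ultimately show ?thesis using that by blast
qed

section \<open>Large-scale Lipschitz constants\<close>

text \<open>Convexity of the domain: the segment is cut into \<open>n\<close> equal pieces, each of
  length at most \<open>s\<close>.\<close>

lemma chain_bound:
  fixes V :: "'a::real_normed_vector \<Rightarrow> 'b::real_normed_vector"
  assumes "\<And>x y. norm (x - y) \<le> s \<Longrightarrow> norm (V x - V y) \<le> M"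
  shows "norm (x - y) \<le> real n * s \<Longrightarrow> norm (V x - V y) \<le> real n * M"
proof (induction n arbitrary: x)
  case (Suc n)
  define z where "z = x + (1 / real (Suc n)) *\<^sub>R (y - x)"
  have "norm (x - z) = norm (x - y) / real (Suc n)"
    by (simp add: z_def norm_minus_commute)
  also have "\<dots> \<le> s" using Suc.prems by (simp add: field_simps)
  finally have 1: "norm (V x - V z) \<le> M" by (rule assms)
  have "z - y = (real n / real (Suc n)) *\<^sub>R (x - y)"
  proof -
    have "z - y = (1 - 1 / real (Suc n)) *\<^sub>R (x - y)" by (simp add: z_def algebra_simps)
    also have "1 - 1 / real (Suc n) = real n / real (Suc n)" by (simp add: field_simps)
    finally show ?thesis .
  qed
  then have "norm (z - y) = (real n / real (Suc n)) * norm (x - y)" by simp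
  also have "\<dots> \<le> (real n / real (Suc n)) * (real (Suc n) * s)"
    using Suc.prems by (intro mult_left_mono) auto
  also have "\<dots> = real n * s" by simp
  finally have "norm (V z - V y) \<le> real n * M" by (rule Suc.IH)
  then show ?case
    using 1 norm_triangle_ineq[of "V x - V z" "V z - V y"] by (simp add: algebra_simps)
qed simp

lemma modulus_bdd:
  fixes V :: "'a::real_normed_vector \<Rightarrow> 'b::real_normed_vector"
  assumes V: "uniformly_continuous_on UNIV V"
  shows "bdd_above {norm (V x - V y) | x y. norm (x - y) \<le> t}"
proof -
  obtain d where d: "0 < d" "\<And>x y. norm (x - y) < d \<Longrightarrow> norm (V x - V y) < 1"
    using V unfolding uniformly_continuous_on_def dist_norm
    by (metis UNIV_I norm_minus_commute zero_less_one)
  obtain n :: nat where "2 * t / d \<le> n" using real_arch_simple by blast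
  then have n: "t \<le> n * (d/2)" using d(1) by (simp add: field_simps)
  have "norm (V x - V y) \<le> real n * 1" if "norm (x - y) \<le> t" for x y
  proof (rule chain_bound[where V = V and s = "d/2"])
    show "norm (x - y) \<le> n * (d/2)" using n that by simp
    show "norm (V u - V v) \<le> 1" if "norm (u - v) \<le> d/2" for u v
      using d(2)[of u v] that d(1) by simp
  qed
  then show ?thesis by (intro bdd_aboveI[of _ "real n * 1"]) blast
qed

lemma modulus_upper:
  assumes "uniformly_continuous_on UNIV V" "norm (x - y) \<le> t"
  shows "norm (V x - V y) \<le> modulus V t"
  unfolding modulus_def using assms(2) by (intro cSup_upper modulus_bdd[OF assms(1)]) blast

lemma modulus_least:
  fixes V :: "'a::real_normed_vector \<Rightarrow> 'b::real_normed_vector"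
  assumes "0 \<le> t" "\<And>x y. norm (x - y) \<le> t \<Longrightarrow> norm (V x - V y) \<le> M"
  shows "modulus V t \<le> M"
  unfolding modulus_def
proof (rule cSup_least)
  have "norm (V 0 - V 0) \<in> {norm (V x - V y) |x y. norm (x - y) \<le> t}" using assms(1) by fastforce
  then show "{norm (V x - V y) |x y. norm (x - y) \<le> t} \<noteq> {}" by blast
qed (use assms(2) in blast)

lemma modulus_nonneg:
  assumes "uniformly_continuous_on UNIV V" "0 \<le> t"
  shows "0 \<le> modulus V t"
  using modulus_upper[OF assms(1), of 0 0 t] assms(2) by simp

text \<open>Fekete's argument: chaining gives \<open>modulus V t \<le> n * modulus V s\<close> with
  \<open>n \<le> t / s + 1\<close>, and the rounding error \<open>modulus V s / t\<close> vanishes,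
  so the infimum of the quotients is their limit. Hence \<open>unif_norm\<close> is a genuine
  limit.\<close>

lemma modulus_tendsto:
  assumes V: "uniformly_continuous_on UNIV V"
  defines "L \<equiv> Inf ((\<lambda>s. modulus V s / s) ` {0<..})"
  shows "((\<lambda>t. modulus V t / t) \<longlongrightarrow> L) at_top" "0 \<le> L"
proof -
  have ne: "(\<lambda>s. modulus V s / s) ` {0<..} \<noteq> {}" by auto
  have nonneg: "0 \<le> modulus V s / s" if "0 < s" for s
    using modulus_nonneg[OF V, of s] that by simp
  have bdd: "bdd_below ((\<lambda>s. modulus V s / s) ` {0<..})"
    using nonneg by (intro bdd_belowI2[of _ 0]) auto
  show "0 \<le> L" unfolding L_def using nonneg by (intro cInf_greatest[OF ne]) auto
  have lower: "L \<le> modulus V s / s" if "0 < s" for s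
    unfolding L_def using that by (intro cInf_lower[OF _ bdd]) auto
  show "((\<lambda>t. modulus V t / t) \<longlongrightarrow> L) at_top"
  proof (rule tendstoI)
    fix e :: real assume e: "0 < e"
    obtain s where s: "0 < s" "modulus V s / s < L + e/2"
      using cInf_lessD[OF ne, of "L + e/2"] e by (auto simp: L_def)
    have "modulus V t / t < L + e" if t: "t > max s (2 * modulus V s / e)" for t
    proof -
      have t0: "0 < t" using t s by simp
      define n where "n = nat \<lceil>t / s\<rceil>"
      have n: "t / s \<le> n" "n \<le> t / s + 1" using t0 s by (auto simp: n_def)
      have "modulus V t \<le> n * modulus V s"
      proof (rule modulus_least)
        fix x y :: 'a assume "norm (x - y) \<le> t"
        then have "norm (x - y) \<le> n * s" using n(1) s(1) by (simp add: pos_divide_le_eq)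
        then show "norm (V x - V y) \<le> n * modulus V s" by (intro chain_bound[where V = V, OF modulus_upper[OF V]])
      qed (use t0 in simp)
      also have "\<dots> \<le> (t / s + 1) * modulus V s"
        using n(2) modulus_nonneg[OF V, of s] s(1) by (intro mult_right_mono) auto
      finally have "modulus V t / t \<le> (t / s + 1) * modulus V s / t"
        using t0 by (intro divide_right_mono) auto
      also have "\<dots> = modulus V s / s + modulus V s / t" using t0 s(1) by (simp add: field_simps)
      also have "modulus V s / t < e / 2" using t t0 e by (simp add: field_simps)
      finally show ?thesis using s(2) by simp
    qed
    moreover have "0 < t" if "t > max s (2 * modulus V s / e)" for t using s(1) that by simp
    ultimately have "dist (modulus V t / t) L < e" if "t > max s (2 * modulus V s / e)" for t
      using lower[of t] that by (force simp: dist_real_def)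
    then show "\<forall>\<^sub>F t in at_top. dist (modulus V t / t) L < e"
      by (intro eventually_mono[OF eventually_gt_at_top]) blast
  qed
qed

lemma unif_norm_nonneg:
  assumes "uniformly_continuous_on UNIV V"
  shows "0 \<le> unif_norm V"
  using modulus_tendsto[OF assms] by (simp add: unif_norm_def tendsto_Lim)

text \<open>The bound is in terms of the scale \<open>s\<close> instead of the distance, so it also
  covers pairs closer than \<open>t0\<close>.\<close>

lemma large_scale_Lipschitz:
  fixes V :: "'a::real_normed_vector \<Rightarrow> 'b::real_normed_vector"
  assumes V: "uniformly_continuous_on UNIV V" and a: "unif_norm V < a"
  obtains t0 where "0 < t0"
    "\<And>s x y. t0 \<le> s \<Longrightarrow> norm (x - y) \<le> s \<Longrightarrow> norm (V x - V y) \<le> a * s"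
proof -
  have "((\<lambda>t. modulus V t / t) \<longlongrightarrow> unif_norm V) at_top"
    using modulus_tendsto[OF V] by (simp add: unif_norm_def tendsto_Lim)
  then have "\<forall>\<^sub>F t in at_top. modulus V t / t < a" using a by (rule order_tendstoD)
  then obtain T where T: "\<And>t. T \<le> t \<Longrightarrow> modulus V t / t < a" by (auto simp: eventually_at_top_linorder)
  have "norm (V x - V y) \<le> a * s" if "max T 1 \<le> s" "norm (x - y) \<le> s" for s x y
    using T[of s] modulus_upper[OF V that(2)] that(1) by (simp add: field_simps)
  then show ?thesis using that[of "max T 1"] by simp
qed

section \<open>Renorming with a prescribed dual norm\<close>

definition support :: "'a::real_normed_vector set \<Rightarrow> ('a \<Rightarrow>\<^sub>L real) \<Rightarrow> real" where
  "support A f = (SUP v\<in>A. blinfun_apply f v)"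

definition symmetric_bounded :: "real \<Rightarrow> 'a::real_normed_vector set \<Rightarrow> bool" where
  "symmetric_bounded a A \<longleftrightarrow> A \<noteq> {} \<and> (\<forall>v\<in>A. - v \<in> A) \<and> (\<forall>v\<in>A. norm v \<le> a)"

lemma symmetric_boundedD:
  assumes "symmetric_bounded a A"
  shows "A \<noteq> {}" "v \<in> A \<Longrightarrow> - v \<in> A" "v \<in> A \<Longrightarrow> norm v \<le> a"
  using assms by (auto simp: symmetric_bounded_def)

lemma apply_le_bound:
  fixes f :: "'a::real_normed_vector \<Rightarrow>\<^sub>L real"
  assumes "norm v \<le> a"
  shows "blinfun_apply f v \<le> norm f * a"
  using norm_blinfun[of f v] mult_left_mono[OF assms norm_ge_zero[of f]] by simp

lemma support_bdd:
  fixes f :: "'a::real_normed_vector \<Rightarrow>\<^sub>L real"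
  assumes "symmetric_bounded a A"
  shows "bdd_above (blinfun_apply f ` A)"
  by (rule bdd_aboveI2[where M = "norm f * a"]) (intro apply_le_bound symmetric_boundedD(3)[OF assms])

lemma support_upper: "symmetric_bounded a A \<Longrightarrow> v \<in> A \<Longrightarrow> blinfun_apply f v \<le> support A f"
  unfolding support_def by (rule cSUP_upper[OF _ support_bdd])

lemma support_upper_abs:
  assumes "symmetric_bounded a A" "v \<in> A"
  shows "\<bar>blinfun_apply f v\<bar> \<le> support A f"
  using support_upper[OF assms, of f] support_upper[OF assms(1), of "- v" f]
    symmetric_boundedD(2)[OF assms]
  by (simp add: blinfun.minus_right abs_le_iff)

lemma support_least:
  assumes "symmetric_bounded a A" "\<And>v. v \<in> A \<Longrightarrow> blinfun_apply f v \<le> c"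
  shows "support A f \<le> c"
  unfolding support_def using symmetric_boundedD(1)[OF assms(1)] assms(2) by (rule cSUP_least)

lemma support_approx:
  assumes "symmetric_bounded a A" "c < support A f"
  obtains v where "v \<in> A" "c < blinfun_apply f v"
  using assms less_cSUP_iff[OF symmetric_boundedD(1) support_bdd, OF assms(1) assms(1)]
  by (auto simp: support_def)

lemma support_nonneg:
  assumes "symmetric_bounded a A"
  shows "0 \<le> support A f"
  using symmetric_boundedD(1)[OF assms] support_upper_abs[OF assms] by (meson abs_ge_zero ex_in_conv order_trans)

lemma support_le: "symmetric_bounded a A \<Longrightarrow> support A f \<le> norm f * a"
  using support_least apply_le_bound symmetric_boundedD(3) by metis

lemma support_scaleR:
  assumes A: "symmetric_bounded a A"
  shows "support A (r *\<^sub>R f) \<le> \<bar>r\<bar> * support A f"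
proof (rule support_least[OF A])
  fix v assume "v \<in> A"
  then have "\<bar>r\<bar> * \<bar>blinfun_apply f v\<bar> \<le> \<bar>r\<bar> * support A f"
    using support_upper_abs[OF A] by (intro mult_left_mono) auto
  moreover have "blinfun_apply (r *\<^sub>R f) v \<le> \<bar>r\<bar> * \<bar>blinfun_apply f v\<bar>"
    by (simp add: blinfun.scaleR_left flip: abs_mult)
  ultimately show "blinfun_apply (r *\<^sub>R f) v \<le> \<bar>r\<bar> * support A f" by simp
qed

text \<open>The norm whose dual norm is a prescribed support function is the polar gauge of the polar set,
  so no bipolar theorem is needed.\<close>

lemma norm_with_dual_support:
  fixes A :: "'a::real_normed_vector set"
  assumes A: "symmetric_bounded a A" and ab: "0 < a" "0 < b" "a * b \<le> l"
    and lower: "\<And>f. norm f \<le> b * support A f"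
  obtains N where "equivalent_norm l N" "\<And>f. dual_norm N f = support A f"
proof -
  define S where "S y = {blinfun_apply f y | f. support A f \<le> 1}" for y
  define N where "N y = Sup (S y)" for y
  have nle: "norm f \<le> b" if "support A f \<le> 1" for f
  proof -
    have "b * support A f \<le> b * 1" using ab that by (intro mult_left_mono) auto
    then show ?thesis using lower[of f] by simp
  qed
  have S_le: "c \<le> b * norm y" if c: "c \<in> S y" for c y
  proof -
    obtain f where f: "c = blinfun_apply f y" "support A f \<le> 1" using c by (auto simp: S_def)
    have "norm f * norm y \<le> b * norm y" using nle[OF f(2)] by (intro mult_right_mono) auto
    then show ?thesis using norm_blinfun[of f y] f(1) by simp
  qed
  have bdd: "bdd_above (S y)" for y using S_le by (intro bdd_aboveI)
  have "support A 0 \<le> 1" using support_le[OF A, of 0] by simp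
  then have zero: "0 \<in> S y" for y unfolding S_def by (force intro: exI[of _ 0])
  have up: "blinfun_apply f y \<le> N y" if "support A f \<le> 1" for f y
    unfolding N_def using that by (intro cSup_upper[OF _ bdd]) (auto simp: S_def)
  have least: "N y \<le> c" if "\<And>f. support A f \<le> 1 \<Longrightarrow> blinfun_apply f y \<le> c" for y c
    unfolding N_def using zero that by (intro cSup_least) (auto simp: S_def)
  have nonneg: "0 \<le> N y" for y
    unfolding N_def by (rule cSup_upper[OF zero bdd])
  have N_le: "N y \<le> b * norm y" for y
    unfolding N_def using zero S_le by (intro cSup_least) auto
  have N_ge: "(1 / a) * norm y \<le> N y" for y
  proof -
    obtain g :: "'a \<Rightarrow>\<^sub>L real" where g: "norm g \<le> 1" "blinfun_apply g y = norm y"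
      using norming_functional by blast
    have "support A ((1 / a) *\<^sub>R g) \<le> 1"
      using support_le[OF A, of "(1 / a) *\<^sub>R g"] g(1) ab by simp
    from up[OF this, of y] show ?thesis using g(2) by (simp add: blinfun.scaleR_left)
  qed
  have zero_iff: "N y = 0 \<longleftrightarrow> y = 0" for y
  proof
    assume "N y = 0"
    then have "norm y \<le> 0" using N_ge[of y] ab by (simp add: divide_le_0_iff)
    then show "y = 0" by simp
  next
    assume "y = 0"
    then show "N y = 0" using N_le[of y] nonneg[of y] by simp
  qed
  have hom_le: "N (r *\<^sub>R y) \<le> \<bar>r\<bar> * N y" for r y
  proof (rule least)
    fix f assume f: "support A f \<le> 1"
    have "support A ((sgn r) *\<^sub>R f) \<le> 1"
      using support_scaleR[OF A, of "sgn r" f] f support_nonneg[OF A, of f]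
      by (cases "r = 0") (auto simp: abs_sgn_eq)
    from mult_left_mono[OF up[OF this, of y] abs_ge_zero[of r]]
    have "\<bar>r\<bar> * (sgn r * blinfun_apply f y) \<le> \<bar>r\<bar> * N y" by (simp add: blinfun.scaleR_left)
    moreover have "\<bar>r\<bar> * (sgn r * blinfun_apply f y) = r * blinfun_apply f y"
      by (metis abs_mult_sgn mult.assoc)
    ultimately show "blinfun_apply f (r *\<^sub>R y) \<le> \<bar>r\<bar> * N y"
      by (simp add: blinfun.scaleR_right)
  qed
  have hom: "N (r *\<^sub>R y) = \<bar>r\<bar> * N y" for r y
  proof (cases "r = 0")
    case True
    then show ?thesis using zero_iff[of 0] by simp
  next
    case False
    have "N y \<le> \<bar>inverse r\<bar> * N (r *\<^sub>R y)" using hom_le[of "inverse r" "r *\<^sub>R y"] False by simp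
    then have "\<bar>r\<bar> * N y \<le> N (r *\<^sub>R y)" using False by (simp add: field_simps)
    then show ?thesis using hom_le[of r y] by simp
  qed
  have triangle: "N (x + y) \<le> N x + N y" for x y
    using up by (intro least) (simp add: blinfun.add_right add_mono)
  have "is_norm N" unfolding is_norm_def using nonneg zero_iff hom triangle by blast
  then have equiv: "equivalent_norm l N"
    unfolding equivalent_norm_def using ab N_le N_ge
    by (intro conjI exI[of _ "1 / a"] exI[of _ b]) (auto simp: mult.commute)
  have "dual_norm N f = support A f" for f
  proof (rule antisym)
    show "dual_norm N f \<le> support A f"
    proof (rule dual_norm_least[OF \<open>is_norm N\<close> support_nonneg[OF A]])
      fix y
      let ?h = "support A f"
      show "\<bar>blinfun_apply f y\<bar> \<le> ?h * N y"
      proof (cases "?h = 0")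
        case True
        then have "f = 0" using lower[of f] by simp
        then show ?thesis using True by simp
      next
        case False
        then have h: "0 < ?h" using support_nonneg[OF A, of f] by simp
        have "support A ((1 / ?h) *\<^sub>R f) \<le> 1" "support A ((- (1 / ?h)) *\<^sub>R f) \<le> 1"
          using support_scaleR[OF A, of "1 / ?h" f] support_scaleR[OF A, of "- (1 / ?h)" f] h by auto
        from up[OF this(1), of y] up[OF this(2), of y] show ?thesis
          using h by (simp add: blinfun.minus_left blinfun.scaleR_left abs_le_iff field_simps)
      qed
    qed
    \<comment> \<open>By construction \<open>A\<close> lies in the unit ball of \<open>N\<close>,
      which gives this half at once; the other half comes from normalizing \<open>f\<close> to
      \<open>support A f = 1\<close>.\<close>
    show "support A f \<le> dual_norm N f"
    proof (rule support_least[OF A])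
      fix v assume v: "v \<in> A"
      have "N v \<le> 1" using support_upper[OF A v] by (intro least) (rule order_trans)
      then have "dual_norm N f * N v \<le> dual_norm N f"
        using dual_norm_nonneg[OF equiv] by (simp add: mult_left_le)
      then show "blinfun_apply f v \<le> dual_norm N f" using dual_norm_upper[OF equiv, of f v] by simp
    qed
  qed
  then show ?thesis using that equiv by blast
qed

text \<open>The Minkowski average. Support functions turn Minkowski sums into sums, so an average of
  oscillations is again a support function and thus a dual norm.\<close>

definition average_set :: "nat \<Rightarrow> (nat \<Rightarrow> 'a::real_normed_vector set) \<Rightarrow> 'a set" where
  "average_set K A = {(1 / real K) *\<^sub>R (\<Sum>k<K. v k) | v. \<forall>k<K. v k \<in> A k}"

lemma symmetric_bounded_average:
  assumes A: "\<And>k. k < K \<Longrightarrow> symmetric_bounded a (A k)" and K: "0 < K"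
  shows "symmetric_bounded a (average_set K A)"
  unfolding symmetric_bounded_def
proof (intro conjI ballI)
  have "\<forall>k. \<exists>v. k < K \<longrightarrow> v \<in> A k" using symmetric_boundedD(1)[OF A] by blast
  then show "average_set K A \<noteq> {}" unfolding average_set_def by (fastforce dest: choice)
next
  fix w assume "w \<in> average_set K A"
  then obtain v where v: "w = (1 / real K) *\<^sub>R (\<Sum>k<K. v k)" "\<And>k. k < K \<Longrightarrow> v k \<in> A k"
    by (auto simp: average_set_def)
  have "- w = (1 / real K) *\<^sub>R (\<Sum>k<K. - v k)" by (simp add: v(1) sum_negf)
  moreover have "\<forall>k<K. - v k \<in> A k" using v(2) symmetric_boundedD(2)[OF A] by blast
  ultimately show "- w \<in> average_set K A"
    unfolding average_set_def by (intro CollectI exI[of _ "\<lambda>k. - v k"]) simp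
  have "norm (\<Sum>k<K. v k) \<le> (\<Sum>k<K. a)"
    using v(2) symmetric_boundedD(3)[OF A] by (intro order_trans[OF norm_sum] sum_mono) auto
  then show "norm w \<le> a" using K by (simp add: v(1) field_simps)
qed

lemma support_average:
  assumes A: "\<And>k. k < K \<Longrightarrow> symmetric_bounded a (A k)" and K: "0 < K"
  shows "support (average_set K A) f = (1 / real K) * (\<Sum>k<K. support (A k) f)"
proof (rule antisym)
  have avg: "symmetric_bounded a (average_set K A)" using A K by (rule symmetric_bounded_average)
  show "support (average_set K A) f \<le> (1 / real K) * (\<Sum>k<K. support (A k) f)"
  proof (rule support_least[OF avg])
    fix w assume "w \<in> average_set K A"
    then obtain v where v: "w = (1 / real K) *\<^sub>R (\<Sum>k<K. v k)" "\<And>k. k < K \<Longrightarrow> v k \<in> A k"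
      by (auto simp: average_set_def)
    have "(\<Sum>k<K. blinfun_apply f (v k)) \<le> (\<Sum>k<K. support (A k) f)"
      using v(2) support_upper[OF A] by (intro sum_mono) auto
    then show "blinfun_apply f w \<le> (1 / real K) * (\<Sum>k<K. support (A k) f)"
      using K by (simp add: v(1) blinfun.scaleR_right blinfun.sum_right divide_right_mono)
  qed
  show "(1 / real K) * (\<Sum>k<K. support (A k) f) \<le> support (average_set K A) f"
  proof (rule field_le_epsilon)
    fix e :: real assume e: "0 < e"
    have "\<forall>k. \<exists>v. k < K \<longrightarrow> v \<in> A k \<and> support (A k) f - e < blinfun_apply f v"
      using support_approx[OF A] e by (metis diff_less_eq less_add_same_cancel1)
    then obtain v where v: "\<And>k. k < K \<Longrightarrow> v k \<in> A k"
      "\<And>k. k < K \<Longrightarrow> support (A k) f - e < blinfun_apply f (v k)" by metis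
    let ?w = "(1 / real K) *\<^sub>R (\<Sum>k<K. v k)"
    have "?w \<in> average_set K A" using v(1) by (auto simp: average_set_def)
    then have "blinfun_apply f ?w \<le> support (average_set K A) f" by (rule support_upper[OF avg])
    moreover have "(\<Sum>k<K. support (A k) f - e) \<le> (\<Sum>k<K. blinfun_apply f (v k))"
      using v(2) by (intro sum_mono) (simp add: less_imp_le)
    then have "(1 / real K) * (\<Sum>k<K. support (A k) f - e) \<le> blinfun_apply f ?w"
      unfolding blinfun.scaleR_right blinfun.sum_right real_scaleR_def by (intro mult_left_mono) auto
    then have "(1 / real K) * (\<Sum>k<K. support (A k) f) - e \<le> blinfun_apply f ?w"
      using K by (simp add: sum_subtractf diff_divide_distrib)
    ultimately show "(1 / real K) * (\<Sum>k<K. support (A k) f) \<le> support (average_set K A) f + e" by simp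
  qed
qed

section \<open>The Gorelik principle for uniform homeomorphisms\<close>

text \<open>Only distances at least \<open>s\<close> enter, because at small distances the quotients
  of a uniformly continuous map may be unbounded.\<close>

definition difference_quotients ::
    "('a::real_normed_vector \<Rightarrow> 'b::real_normed_vector) \<Rightarrow> real \<Rightarrow> 'b set" where
  "difference_quotients U s =
     {(1 / norm (x - x')) *\<^sub>R (U x - U x') | x x'. s \<le> norm (x - x')}"

locale large_scale_Lipschitz_homeomorphism =
  fixes U :: "'a::real_normed_vector \<Rightarrow> 'b::real_normed_vector" and a b t0 :: real
  assumes homeo: "uniform_homeomorphism U"
    and pos: "0 < a" "0 < b" "0 < t0"
    and U_le: "\<And>s x x'. t0 \<le> s \<Longrightarrow> norm (x - x') \<le> s \<Longrightarrow> norm (U x - U x') \<le> a * s"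
    and inv_le: "\<And>s y y'. t0 \<le> s \<Longrightarrow> norm (y - y') \<le> s \<Longrightarrow> norm (inv U y - inv U y') \<le> b * s"
    and nontrivial: "\<exists>x :: 'a. x \<noteq> 0"
begin

section \<open>Oscillation of functionals at a fixed scale\<close>

abbreviation osc :: "real \<Rightarrow> ('b \<Rightarrow>\<^sub>L real) \<Rightarrow> real" where
  "osc s \<equiv> support (difference_quotients U s)"

lemma inv_U: "inv U (U x) = x" and U_inv: "U (inv U y) = y"
  using homeo by (auto simp: uniform_homeomorphism_def bij_is_inj bij_is_surj surj_f_inv_f)

lemma uniformly_continuous: "uniformly_continuous_on UNIV U" "uniformly_continuous_on UNIV (inv U)"
  using homeo by (auto simp: uniform_homeomorphism_def)

lemma symmetric_bounded_difference_quotients: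
  assumes s: "t0 \<le> s"
  shows "symmetric_bounded a (difference_quotients U s)"
  unfolding symmetric_bounded_def
proof (intro conjI ballI)
  obtain x :: 'a where x: "x \<noteq> 0" using nontrivial by blast
  have "s \<le> norm ((s / norm x) *\<^sub>R x - 0)" using s pos x by simp
  then show "difference_quotients U s \<noteq> {}" unfolding difference_quotients_def by blast
next
  fix v assume "v \<in> difference_quotients U s"
  then obtain x x' where v: "v = (1 / norm (x - x')) *\<^sub>R (U x - U x')" "s \<le> norm (x - x')"
    by (auto simp: difference_quotients_def)
  have "- v = (1 / norm (x' - x)) *\<^sub>R (U x' - U x)"
    unfolding v(1) by (simp add: norm_minus_commute algebra_simps)
  moreover have "s \<le> norm (x' - x)" using v(2) by (simp add: norm_minus_commute)
  ultimately show "- v \<in> difference_quotients U s" unfolding difference_quotients_def by blast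
  have "norm (U x - U x') \<le> a * norm (x - x')" using U_le[of "norm (x - x')"] v(2) s by simp
  moreover have "0 < norm (x - x')" using v(2) s pos by linarith
  ultimately show "norm v \<le> a" by (simp add: v(1) divide_le_eq)
qed

lemma osc_upper:
  assumes s: "t0 \<le> s" "s \<le> norm (x - x')"
  shows "blinfun_apply f (U x - U x') \<le> osc s f * norm (x - x')"
proof -
  have "(1 / norm (x - x')) *\<^sub>R (U x - U x') \<in> difference_quotients U s"
    using s(2) unfolding difference_quotients_def by blast
  from support_upper[OF symmetric_bounded_difference_quotients[OF s(1)] this, of f]
  have "blinfun_apply f (U x - U x') / norm (x - x') \<le> osc s f"
    by (simp add: blinfun.scaleR_right)
  moreover have "0 < norm (x - x')" using s pos by linarith
  ultimately show ?thesis by (simp add: divide_le_eq)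
qed

lemma osc_approx:
  assumes s: "t0 \<le> s" and e: "0 < e"
  obtains x x' where "s \<le> norm (x - x')" "(osc s f - e) * norm (x - x') < blinfun_apply f (U x - U x')"
proof -
  have "osc s f - e < osc s f" using e by simp
  then obtain v where v: "v \<in> difference_quotients U s" "osc s f - e < blinfun_apply f v"
    by (rule support_approx[OF symmetric_bounded_difference_quotients[OF s]])
  then obtain x x' where x: "v = (1 / norm (x - x')) *\<^sub>R (U x - U x')" "s \<le> norm (x - x')"
    by (auto simp: difference_quotients_def)
  moreover have "0 < norm (x - x')" using x(2) s pos by linarith
  ultimately show ?thesis using v(2) that[of x x'] by (simp add: blinfun.scaleR_right less_divide_eq)
qed

lemma osc_nonneg: "t0 \<le> s \<Longrightarrow> 0 \<le> osc s f"
  by (rule support_nonneg[OF symmetric_bounded_difference_quotients])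

text \<open>\<open>y\<close> is blown up to \<open>T *\<^sub>R y\<close> until it and 0 have
  preimages at distance at least \<open>s\<close>; then the large-scale bound for
  \<open>inv U\<close> applies and \<open>T\<close> cancels.\<close>

lemma norm_le_osc:
  assumes s: "t0 \<le> s"
  shows "norm f \<le> b * osc s f"
proof (rule norm_blinfun_bound)
  show "0 \<le> b * osc s f" using osc_nonneg[OF s] pos by simp
  have *: "blinfun_apply f y \<le> b * osc s f * norm y" for y
  proof (cases "y = 0")
    case False
    \<comment> \<open>The second entry makes the bound for \<open>inv U\<close> applicable. With the
      third, preimages closer than \<open>s\<close> would have images closer than
      \<open>T * norm y\<close>, a contradiction.\<close>
    define T where "T = max 1 (max (t0 / norm y) (2 * a * s / norm y))"
    have T: "0 < T" "t0 \<le> T * norm y" "2 * a * s \<le> T * norm y"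
      using False by (auto simp: T_def pos_divide_le_eq[symmetric])
    let ?x = "inv U (T *\<^sub>R y)" and ?x' = "inv U 0"
    have "s \<le> norm (?x - ?x')"
    proof (rule ccontr)
      assume "\<not> ?thesis"
      then have "norm (U ?x - U ?x') \<le> a * s" using s by (intro U_le) auto
      then have "T * norm y \<le> a * s" using T(1) by (simp add: U_inv)
      moreover have "0 < a * s" using pos s by simp
      ultimately show False using T(3) by simp
    qed
    then have "blinfun_apply f (U ?x - U ?x') \<le> osc s f * norm (?x - ?x')" by (rule osc_upper[OF s])
    also have "\<dots> \<le> osc s f * (b * (T * norm y))"
      using T osc_nonneg[OF s] by (intro mult_left_mono inv_le) auto
    finally have "T * blinfun_apply f y \<le> T * (b * osc s f * norm y)"
      by (simp add: U_inv blinfun.scaleR_right mult_ac)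
    then show ?thesis using T(1) by simp
  qed simp
  show "norm (blinfun_apply f y) \<le> b * osc s f * norm y" for y
    using *[of y] *[of "- y"] by (simp add: blinfun.minus_right abs_le_iff)
qed

text \<open>\<open>weak_Gorelik\<close> for translations by \<open>y\<close> conjugated with
  \<open>U\<close> and recentred at \<open>m\<close>. The bound for \<open>inv U\<close> at scale
  \<open>r\<close> limits their displacement, and they are equicontinuous because translations are
  isometries.\<close>

lemma Gorelik_principle:
  fixes J :: "('a \<Rightarrow>\<^sub>L real) set"
  assumes J: "finite J" and d: "0 < d" and r: "t0 \<le> r"
  obtains A where "finite A"
    "\<And>y. norm y \<le> r \<Longrightarrow> \<exists>x\<in>A. \<exists>z. U (m + z) = U (m + x) + y \<and> norm z \<le> 2 * (b * r) + d \<and>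
       (\<forall>f\<in>J. \<bar>blinfun_apply f z\<bar> \<le> d)"
proof -
  define \<Phi> where "\<Phi> y x = inv U (U (m + x) + y) - m" for y x
  have disp: "norm (x - \<Phi> y x) \<le> b * r" if y: "y \<in> cball 0 r" for y x
    using inv_le[OF r, of "U (m + x)" "U (m + x) + y"] y by (simp add: \<Phi>_def inv_U algebra_simps)
  have equi: "\<exists>h>0. \<forall>y\<in>cball 0 r. \<forall>x x'. norm (x - x') < h \<longrightarrow> norm (\<Phi> y x - \<Phi> y x') < e"
    if e: "0 < e" for e
  proof -
    obtain k where k: "0 < k" "\<And>u v. norm (u - v) < k \<Longrightarrow> norm (inv U u - inv U v) < e"
      using uniformly_continuous(2) e unfolding uniformly_continuous_on_def dist_norm
      by (metis UNIV_I)
    obtain h where h: "0 < h" "\<And>u v. norm (u - v) < h \<Longrightarrow> norm (U u - U v) < k"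
      using uniformly_continuous(1) k(1) unfolding uniformly_continuous_on_def dist_norm
      by (metis UNIV_I)
    have "norm (\<Phi> y x - \<Phi> y x') < e" if "norm (x - x') < h" for x x' y
    proof -
      have "norm (U (m + x) - U (m + x')) < k" using that by (intro h(2)) simp
      then have "norm (inv U (U (m + x) + y) - inv U (U (m + x') + y)) < e" by (intro k(2)) simp
      then show ?thesis by (simp add: \<Phi>_def)
    qed
    then show ?thesis using h(1) by blast
  qed
  have "0 < b * r" using pos r by simp
  from weak_Gorelik[OF J d this disp equi] obtain A where A: "finite A"
    "\<And>y. y \<in> cball 0 r \<Longrightarrow> \<exists>x\<in>A. norm (\<Phi> y x) \<le> 2 * (b * r) + d \<and> (\<forall>f\<in>J. \<bar>blinfun_apply f (\<Phi> y x)\<bar> \<le> d)"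
    by blast
  have "U (m + \<Phi> y x) = U (m + x) + y" for y x by (simp add: \<Phi>_def U_inv)
  then have "\<exists>x\<in>A. \<exists>z. U (m + z) = U (m + x) + y \<and> norm z \<le> 2 * (b * r) + d \<and>
       (\<forall>f\<in>J. \<bar>blinfun_apply f z\<bar> \<le> d)" if "norm y \<le> r" for y
    using A(2)[of y] that by (metis mem_cball_0)
  then show ?thesis using that A(1) by blast
qed

lemma apply_less_of_norm_greater:
  fixes g :: "'b \<Rightarrow>\<^sub>L real"
  assumes "\<mu> < norm g" "0 \<le> \<mu>" "0 < r"
  obtains y where "norm y \<le> r" "blinfun_apply g y \<le> - (r * \<mu>)"
proof -
  obtain v where v: "\<mu> * norm v < \<bar>blinfun_apply g v\<bar>"
    using norm_blinfun_bound[OF assms(2), of g] assms(1) by (metis not_le real_norm_def)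
  then have "v \<noteq> 0" by auto
  define y where "y = (- sgn (blinfun_apply g v) * r / norm v) *\<^sub>R v"
  have "norm y \<le> r" using \<open>v \<noteq> 0\<close> assms(3) by (simp add: y_def abs_mult abs_sgn_eq)
  moreover have "blinfun_apply g y = - (r * (\<bar>blinfun_apply g v\<bar> / norm v))"
    by (simp add: y_def blinfun.scaleR_right blinfun.minus_right abs_sgn)
  moreover have "\<mu> \<le> \<bar>blinfun_apply g v\<bar> / norm v" using v \<open>v \<noteq> 0\<close> by (simp add: le_divide_eq)
  then have "r * \<mu> \<le> r * (\<bar>blinfun_apply g v\<bar> / norm v)" using assms(3) by (intro mult_left_mono) auto
  ultimately show ?thesis by (intro that[of y]) linarith+
qed

text \<open>The bound compares the scales \<open>s\<close> and \<open>4 * s\<close>: the pair \<open>p, q\<close> is taken at the larger scale so that the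
  perturbed point \<open>m + z\<close> is still at distance at least \<open>s\<close> from both ends.\<close>

lemma osc_add_weak_star_null:
  assumes sep: "separable_infinite_dimensional TYPE('a)"
    and c: "theta_bound (norm :: 'a \<Rightarrow> real) t c" "0 < c" "c \<le> t"
    and \<delta>: "0 < \<delta>" and \<eta>: "0 < \<eta>" and \<mu>: "0 \<le> \<mu>"
    and s: "t0 \<le> s" "3 * b * t0 \<le> c / t * s"
    and null: "weak_star_null zs"
  shows "\<forall>\<^sub>F n in sequentially. \<mu> < norm (zs n) \<longrightarrow>
    2 * osc (4 * s) f - (1 + c + \<delta>) * osc s f + c / t / (3 * b) * \<mu> - \<eta>
      \<le> (1 + c + \<delta>) * osc s (f + zs n)"
proof -
  let ?D = "1 + c + \<delta>"
  define \<sigma> where "\<sigma> = c / t"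
  have \<sigma>: "0 < \<sigma>" using c by (simp add: \<sigma>_def)
  have s0: "0 < s" "t0 \<le> 4 * s" using s pos by auto
  obtain p q where pq: "4 * s \<le> norm (p - q)"
    "(osc (4 * s) f - \<eta>/4) * norm (p - q) < blinfun_apply f (U p - U q)"
    using osc_approx[OF s0(2), of "\<eta>/4"] \<eta> by auto
  \<comment> \<open>The midpoint is going to be perturbed, and each half of the pair is compared
    with its own side. Half the distance, \<open>\<rho>\<close>, is at least \<open>2 * s\<close>,
    so a loss of \<open>s\<close> is affordable.\<close>
  define m where "m = (1/2) *\<^sub>R (p + q)"
  define u where "u = (1/2) *\<^sub>R (p - q)"
  have p: "p = m + u" and q: "q = m - u"
    by (simp_all add: m_def u_def algebra_simps flip: scaleR_add_left)
  define \<rho> where "\<rho> = norm u"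
  have \<rho>: "norm (p - q) = 2 * \<rho>" by (simp add: \<rho>_def u_def)
  have \<rho>s: "2 * s \<le> \<rho>" "0 < \<rho>" using pq(1) \<rho> s0 by auto
  then have "u \<noteq> 0" by (auto simp: \<rho>_def)
  obtain J :: "('a \<Rightarrow>\<^sub>L real) set" and d where J: "finite J" "0 < d" and smooth:
    "\<And>z. (\<forall>f\<in>J. \<bar>blinfun_apply f z\<bar> \<le> d) \<Longrightarrow> norm z \<le> \<sigma> * \<rho> \<Longrightarrow> norm (u + z) \<le> ?D * \<rho>"
    using asymptotic_smoothness[OF sep c \<delta> \<open>u \<noteq> 0\<close>] unfolding \<sigma>_def \<rho>_def by blast
  \<comment> \<open>Adding a norming functional of \<open>u\<close> to \<open>J\<close> keeps
    \<open>norm (u + z)\<close> and \<open>norm (u - z)\<close> at least \<open>\<rho> - d'\<close>,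
    hence at least \<open>s\<close>.\<close>
  obtain g0 :: "'a \<Rightarrow>\<^sub>L real" where g0: "norm g0 \<le> 1" "blinfun_apply g0 u = \<rho>"
    using norming_functional unfolding \<rho>_def by blast
  define d' where "d' = min (min d s) (\<sigma> * \<rho> / 3)"
  have d': "0 < d'" "d' \<le> d" "d' \<le> s" "d' \<le> \<sigma> * \<rho> / 3" using J(2) s0 \<sigma> \<rho>s by (auto simp: d'_def)
  \<comment> \<open>With this radius \<open>2 * (b * r) + d'\<close> is at most
    \<open>\<sigma> * \<rho>\<close>, the range of the smoothness estimate; the assumption relating
    \<open>t0\<close> to \<open>c / t * s\<close> makes \<open>r\<close> an admissible
    scale.\<close>
  define r where "r = \<sigma> * \<rho> / (3 * b)"
  have "\<sigma> * s \<le> \<sigma> * \<rho>" using \<sigma> \<rho>s s0 by (intro mult_left_mono) auto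
  then have "3 * b * t0 \<le> \<sigma> * \<rho>" using s(2) unfolding \<sigma>_def by linarith
  then have r: "t0 \<le> r" unfolding r_def using pos by (simp add: le_divide_eq mult_ac)
  have br: "b * r = \<sigma> * \<rho> / 3" using pos by (simp add: r_def)
  \<comment> \<open>\<open>A\<close> is fixed before \<open>n\<close>, so \<open>zs n\<close> is
    eventually small on all \<open>U p - U (m + x)\<close> with \<open>x \<in> A\<close>
    simultaneously. The vector \<open>y\<close> on which \<open>zs n\<close> is very negative may
    then be chosen depending on \<open>n\<close>.\<close>
  obtain A where A: "finite A"
    "\<And>y. norm y \<le> r \<Longrightarrow> \<exists>x\<in>A. \<exists>z. U (m + z) = U (m + x) + y \<and> norm z \<le> 2 * (b * r) + d' \<and>
       (\<forall>f\<in>insert g0 J. \<bar>blinfun_apply f z\<bar> \<le> d')"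
    using Gorelik_principle[of "insert g0 J" d' r m] J(1) d'(1) r by auto
  have "\<forall>\<^sub>F n in sequentially. \<forall>x\<in>A. \<bar>blinfun_apply (zs n) (U p - U (m + x))\<bar> < \<eta> * \<rho> / 4"
  proof (intro eventually_ball_finite A(1) ballI)
    fix x
    have "(\<lambda>n. blinfun_apply (zs n) (U p - U (m + x))) \<longlonglongrightarrow> 0"
      using null by (simp add: weak_star_null_def)
    from tendstoD[OF this, of "\<eta> * \<rho> / 4"]
    show "\<forall>\<^sub>F n in sequentially. \<bar>blinfun_apply (zs n) (U p - U (m + x))\<bar> < \<eta> * \<rho> / 4"
      using \<eta> \<rho>s by simp
  qed
  then show ?thesis
  proof eventually_elim
    case (elim n)
    show ?case
    proof
      assume "\<mu> < norm (zs n)"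
      moreover have "0 < r" using r pos by simp
      ultimately obtain y where y: "norm y \<le> r" "blinfun_apply (zs n) y \<le> - (r * \<mu>)"
        using apply_less_of_norm_greater \<mu> by blast
      obtain x z where x: "x \<in> A" and z: "U (m + z) = U (m + x) + y" "norm z \<le> 2 * (b * r) + d'"
        "\<And>f. f \<in> insert g0 J \<Longrightarrow> \<bar>blinfun_apply f z\<bar> \<le> d'"
        using A(2)[OF y(1)] by blast
      have zJ: "\<forall>f\<in>J. \<bar>blinfun_apply f z\<bar> \<le> d" using z(3) d'(2) by force
      have z\<sigma>: "norm z \<le> \<sigma> * \<rho>" using z(2) br d'(4) by simp
      have up: "norm (u + z) \<le> ?D * \<rho>" using zJ z\<sigma> by (rule smooth)
      have um: "norm (u - z) \<le> ?D * \<rho>"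
        using smooth[of "- z"] zJ z\<sigma> by (simp add: blinfun.minus_right)
      have low: "s \<le> norm (u + v)" if "\<bar>blinfun_apply g0 v\<bar> \<le> d'" for v
      proof -
        have "norm g0 * norm (u + v) \<le> norm (u + v)" using g0(1) by (simp add: mult_left_le_one_le)
        then have "blinfun_apply g0 (u + v) \<le> norm (u + v)" using norm_blinfun[of g0 "u + v"] by simp
        then show ?thesis using that g0(2) \<rho>s d'(3) by (simp add: blinfun.add_right)
      qed
      have lp: "s \<le> norm (u + z)" using z(3) by (intro low) simp
      have lm: "s \<le> norm (u - z)" using low[of "- z"] z(3)[of g0] by (simp add: blinfun.minus_right)
      have "blinfun_apply f (U (m + z) - U q) \<le> osc s f * norm (u + z)"
        using osc_upper[OF s(1), of "m + z" q f] lp by (simp add: q add.commute)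
      also have "\<dots> \<le> osc s f * (?D * \<rho>)" using up osc_nonneg[OF s(1)] by (intro mult_left_mono)
      finally have 1: "blinfun_apply f (U (m + z) - U q) \<le> osc s f * (?D * \<rho>)" .
      have "blinfun_apply (f + zs n) (U p - U (m + z)) \<le> osc s (f + zs n) * norm (u - z)"
        using osc_upper[OF s(1), of p "m + z" "f + zs n"] lm by (simp add: p)
      also have "\<dots> \<le> osc s (f + zs n) * (?D * \<rho>)" using um osc_nonneg[OF s(1)] by (intro mult_left_mono)
      finally have 2: "blinfun_apply (f + zs n) (U p - U (m + z)) \<le> osc s (f + zs n) * (?D * \<rho>)" .
      \<comment> \<open>The four terms: nearly \<open>osc (4 * s) f\<close> times
        \<open>2 * \<rho>\<close>, the half controlled by \<open>osc s f\<close>, the weak* null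
        error on \<open>A\<close>, and the gain \<open>r * \<mu>\<close> from
        \<open>y\<close>.\<close>
      have "blinfun_apply (f + zs n) (U p - U (m + z)) = blinfun_apply f (U p - U q)
          - blinfun_apply f (U (m + z) - U q) + blinfun_apply (zs n) (U p - U (m + x)) - blinfun_apply (zs n) y"
        by (simp add: z(1) blinfun.add_left blinfun.diff_right blinfun.add_right)
      then have "(osc (4 * s) f - \<eta>/4) * (2 * \<rho>) - osc s f * (?D * \<rho>) - \<eta> * \<rho> / 4 + r * \<mu>
          \<le> osc s (f + zs n) * (?D * \<rho>)"
        using 1 2 pq(2) y(2) elim x \<rho> by (smt (verit, best))
      moreover have "r * \<mu> = (c / t / (3 * b) * \<mu>) * \<rho>" by (simp add: r_def \<sigma>_def)
      moreover have "0 < \<eta> * \<rho>" using \<eta> \<rho>s by simp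
      ultimately have "(2 * osc (4 * s) f - ?D * osc s f + c / t / (3 * b) * \<mu> - \<eta>) * \<rho>
          \<le> (?D * osc s (f + zs n)) * \<rho>"
        by (simp add: algebra_simps)
      then show "2 * osc (4 * s) f - ?D * osc s f + c / t / (3 * b) * \<mu> - \<eta> \<le> ?D * osc s (f + zs n)"
        using \<rho>s(2) by simp
    qed
  qed
qed

end

text \<open>The strict inequality leaves room to raise both asymptotic constants by the same small
  \<open>e\<close>, which makes them positive and attained from some finite scale on.\<close>

lemma uniform_homeomorphism_near_unif_dist:
  assumes "uniformly_homeomorphic TYPE('a::real_normed_vector) TYPE('b::real_normed_vector)"
    and l: "unif_dist TYPE('a) TYPE('b) < l"
    and nontrivial: "\<exists>x :: 'a. x \<noteq> 0"
  shows "\<exists>(U :: 'a \<Rightarrow> 'b) a b t0. large_scale_Lipschitz_homeomorphism U a b t0 \<and> a * b \<le> l"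
proof -
  have "{unif_norm U * unif_norm (inv U) | U :: 'a \<Rightarrow> 'b. uniform_homeomorphism U} \<noteq> {}"
    using assms(1) by (auto simp: uniformly_homeomorphic_def)
  from cInf_lessD[OF this, of l] obtain U :: "'a \<Rightarrow> 'b" where U: "uniform_homeomorphism U"
    "unif_norm U * unif_norm (inv U) < l" using l by (auto simp: unif_dist_def)
  then have uc: "uniformly_continuous_on UNIV U" "uniformly_continuous_on UNIV (inv U)"
    by (auto simp: uniform_homeomorphism_def)
  have "((\<lambda>e. (unif_norm U + e) * (unif_norm (inv U) + e)) \<longlongrightarrow> (unif_norm U + 0) * (unif_norm (inv U) + 0)) (at_right 0)"
    by (intro tendsto_intros)
  then have "\<forall>\<^sub>F e in at_right 0. (unif_norm U + e) * (unif_norm (inv U) + e) < l"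
    using U(2) by (intro order_tendstoD) auto
  moreover have "\<forall>\<^sub>F e in at_right 0. (0::real) < e" by (rule eventually_at_right_less)
  ultimately have "\<forall>\<^sub>F e in at_right 0. 0 < e \<and> (unif_norm U + e) * (unif_norm (inv U) + e) < l"
    by eventually_elim simp
  then obtain e where e: "0 < e" "(unif_norm U + e) * (unif_norm (inv U) + e) < l"
    by (metis (no_types, lifting) eventually_happens trivial_limit_at_right_real)
  obtain t1 where t1: "0 < t1" "\<And>s x y. t1 \<le> s \<Longrightarrow> norm (x - y) \<le> s \<Longrightarrow> norm (U x - U y) \<le> (unif_norm U + e) * s"
    using large_scale_Lipschitz[OF uc(1), of "unif_norm U + e"] e(1) by auto
  obtain t2 where t2: "0 < t2" "\<And>s x y. t2 \<le> s \<Longrightarrow> norm (x - y) \<le> s \<Longrightarrow> norm (inv U x - inv U y) \<le> (unif_norm (inv U) + e) * s"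
    using large_scale_Lipschitz[OF uc(2), of "unif_norm (inv U) + e"] e(1) by auto
  have "large_scale_Lipschitz_homeomorphism U (unif_norm U + e) (unif_norm (inv U) + e) (max t1 t2)"
    using unif_norm_nonneg[OF uc(1)] unif_norm_nonneg[OF uc(2)] e t1 t2 U(1) nontrivial
    by unfold_locales auto
  then show ?thesis using e(2) less_imp_le by blast
qed

section \<open>The averaged norm\<close>

lemma sum_shift_telescope:
  fixes g :: "nat \<Rightarrow> real"
  shows "(\<Sum>k<K. g (Suc k)) = (\<Sum>k<K. g k) - g 0 + g K"
  using sum_lessThan_telescope[of g K] by (simp add: sum_subtractf)

context large_scale_Lipschitz_homeomorphism
begin

text \<open>Averaging over \<open>K\<close> scales makes the loss between consecutive scales telescope to \<open>O(1 / K)\<close>.\<close>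

lemma averaged_renorming:
  assumes l: "a * b \<le> l" and K: "0 < K" and s0: "t0 \<le> s0"
  obtains N where "equivalent_norm l N"
    "\<And>f. dual_norm N f = (1 / real K) * (\<Sum>k<K. osc (4 ^ k * s0) f)"
proof -
  let ?A = "\<lambda>k. difference_quotients U (4 ^ k * s0)"
  have scale: "t0 \<le> 4 ^ k * s0" for k :: nat
  proof -
    have "1 * s0 \<le> 4 ^ k * s0" using s0 pos by (intro mult_right_mono) auto
    then show ?thesis using s0 by simp
  qed
  have A: "symmetric_bounded a (?A k)" for k
    by (rule symmetric_bounded_difference_quotients[OF scale])
  have avg: "support (average_set K ?A) f = (1 / real K) * (\<Sum>k<K. osc (4 ^ k * s0) f)" for f
    using A K by (rule support_average)
  have lower: "norm f \<le> b * support (average_set K ?A) f" for f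
  proof -
    have "real K * norm f = (\<Sum>k<K. norm f)" by simp
    also have "\<dots> \<le> (\<Sum>k<K. b * osc (4 ^ k * s0) f)" by (intro sum_mono norm_le_osc scale)
    also have "\<dots> = b * (\<Sum>k<K. osc (4 ^ k * s0) f)" by (simp add: sum_distrib_left)
    finally show ?thesis unfolding avg using K by (simp add: field_simps)
  qed
  obtain N where "equivalent_norm l N" "\<And>f. dual_norm N f = support (average_set K ?A) f"
    using norm_with_dual_support[OF symmetric_bounded_average[OF A K] pos(1,2) l lower] by blast
  then show ?thesis using that[of N] by (simp add: avg)
qed

text \<open>The estimates at the \<open>K\<close> scales are added. At \<open>f\<close> the
  oscillations sum to \<open>K\<close> since its dual norm is 1, and the shift by one scale leaves
  only end terms. \<open>K\<close> and \<open>s0\<close> are constrained without reference to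
  \<tau>.\<close>

lemma theta_bound_average:
  fixes N :: "'b \<Rightarrow> real"
  assumes sepA: "separable_infinite_dimensional TYPE('a)"
    and l: "a * b \<le> l" and N: "equivalent_norm l N" and K: "0 < K" "2 * l \<le> \<epsilon> / 3 * K"
    and s0: "t0 \<le> s0" "3 * b * t0 \<le> \<epsilon> * s0"
    and F: "\<And>f. dual_norm N f = (1 / real K) * (\<Sum>k<K. osc (4 ^ k * s0) f)"
    and \<tau>: "0 \<le> \<tau>" "\<tau> \<le> 1" and c: "theta_bound (norm :: 'a \<Rightarrow> real) (\<tau> / (32 * l\<^sup>2)) c"
    and ct: "c \<le> \<tau> / (32 * l\<^sup>2)" and c\<epsilon>: "\<epsilon> < c" and \<epsilon>: "0 < \<epsilon>"
  shows "theta_bound N \<tau> (c - \<epsilon>)"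
proof -
  define t where "t = \<tau> / (32 * l\<^sup>2)"
  note c = c[folded t_def] and ct = ct[folded t_def]
  have l0: "0 < l" using mult_pos_pos[OF pos(1,2)] l by simp
  define sc where "sc k = 4 ^ k * s0" for k :: nat
  have scale: "s0 \<le> sc k" for k
    using s0 pos mult_right_mono[of 1 "4 ^ k" s0] by (simp add: sc_def)
  then have sct: "t0 \<le> sc k" for k using s0(1) order_trans by blast
  note F = F[folded sc_def]
  have F_le: "dual_norm N f \<le> a * norm f" for f
  proof -
    have "(\<Sum>k<K. osc (sc k) f) \<le> (\<Sum>k<K. norm f * a)"
      by (intro sum_mono support_le[OF symmetric_bounded_difference_quotients] sct)
    then show ?thesis using K(1) by (simp add: F field_simps)
  qed
  have F_ge: "norm f \<le> b * dual_norm N f" for f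
  proof -
    have "(\<Sum>k<K. norm f) \<le> (\<Sum>k<K. b * osc (sc k) f)" by (intro sum_mono norm_le_osc sct)
    also have "\<dots> = b * (\<Sum>k<K. osc (sc k) f)" by (simp add: sum_distrib_left)
    finally show ?thesis unfolding F using K(1) by (simp add: field_simps)
  qed
  show ?thesis
  unfolding theta_bound_def
  proof (intro allI impI)
    fix f zs
    assume *: "dual_norm N f = 1 \<and> weak_star_null zs \<and>
      ereal \<tau> \<le> liminf (\<lambda>n. ereal (dual_norm N (zs n)))"
    then have null: "weak_star_null zs" by blast
    have c0: "0 < c" using c\<epsilon> \<epsilon> by simp
    have t0': "0 < t" using c0 ct by simp
    have \<tau>0: "0 < \<tau>" using t0' l0 by (simp add: t_def zero_less_divide_iff)
    \<comment> \<open>Read off from \<open>f\<close>, whose dual norm 1 is compared with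
      \<open>norm f\<close> in both directions.\<close>
    have "1 \<le> a * b"
    proof -
      have "norm f \<le> b * 1" "1 \<le> a * norm f" using F_ge[of f] F_le[of f] * by auto
      then show ?thesis using mult_left_mono[of "norm f" b a] pos by linarith
    qed
    then have l1: "1 \<le> l" using l by simp
    have "t \<le> \<tau>"
    proof -
      have "1 \<le> l\<^sup>2" using l1 by simp
      then show ?thesis unfolding t_def using \<tau> by (simp add: divide_le_eq mult_le_cancel_left1)
    qed
    then have t1: "t \<le> 1" "c \<le> 1" using \<tau> ct by auto
    define \<delta> where "\<delta> = \<epsilon> / 9"
    define \<eta> where "\<eta> = \<epsilon> / 3"
    \<comment> \<open>The dual norms of \<open>zs n\<close> eventually exceed
      \<open>\<tau> / 2\<close>, and the dual norm is at most \<open>a\<close> times the original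
      one.\<close>
    define \<mu> where "\<mu> = \<tau> / (2 * a)"
    define D where "D = 1 + c + \<delta>"
    have pos': "0 < \<delta>" "0 < \<eta>" "0 \<le> \<mu>" using \<epsilon> pos \<tau> by (auto simp: \<delta>_def \<eta>_def \<mu>_def)
    \<comment> \<open>Since \<open>t \<le> 1\<close> and \<open>\<epsilon> < c\<close>, the choice
      of \<open>s0\<close> against \<epsilon> fits every \<tau>.\<close>
    have "\<epsilon> * 1 \<le> c / t" using c\<epsilon> t0' t1 mult_mono[of \<epsilon> c t 1] \<epsilon> by (simp add: le_divide_eq)
    then have big: "3 * b * t0 \<le> c / t * sc k" for k
      using s0 scale[of k] mult_mono[of \<epsilon> "c / t" s0 "sc k"] \<epsilon> c0 t0' pos by simp
    have bonus: "5 * c \<le> c / t / (3 * b) * \<mu>"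
    proof -
      have "c / t / (3 * b) * \<mu> = c * (32 * l\<^sup>2) / (6 * (a * b))"
        using \<tau>0 l0 pos by (simp add: \<mu>_def t_def)
      also have "\<dots> \<ge> c * (32 * l\<^sup>2) / (6 * l)"
        using c0 pos l l0 by (intro divide_left_mono) auto
      also have "c * (32 * l\<^sup>2) / (6 * l) = c * (32 / 6) * l" using l0 by (simp add: power2_eq_square)
      also have "\<dots> \<ge> c * 5 * 1" using c0 l1 by (intro mult_mono) auto
      finally show ?thesis by simp
    qed
    have "\<forall>\<^sub>F n in sequentially. \<forall>k\<in>{..<K}. \<mu> < norm (zs n) \<longrightarrow>
        2 * osc (sc (Suc k)) f - D * osc (sc k) f + 5 * c - \<eta> \<le> D * osc (sc k) (f + zs n)"
    proof -
      have "\<forall>\<^sub>F n in sequentially. \<mu> < norm (zs n) \<longrightarrow>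
        2 * osc (sc (Suc k)) f - D * osc (sc k) f + 5 * c - \<eta> \<le> D * osc (sc k) (f + zs n)" for k
        using osc_add_weak_star_null[OF sepA c c0 ct pos' sct[of k] big[of k] null, of f]
      proof eventually_elim
        case (elim n)
        have sc4: "4 * sc k = sc (Suc k)" by (simp add: sc_def)
        show ?case
        proof
          assume "\<mu> < norm (zs n)"
          with elim have "2 * osc (4 * sc k) f - D * osc (sc k) f + c / t / (3 * b) * \<mu> - \<eta>
              \<le> D * osc (sc k) (f + zs n)" unfolding D_def by blast
          then show "2 * osc (sc (Suc k)) f - D * osc (sc k) f + 5 * c - \<eta> \<le> D * osc (sc k) (f + zs n)"
            using bonus unfolding sc4 by linarith
        qed
      qed
      then show ?thesis unfolding eventually_ball_finite_distrib[OF finite_lessThan] by blast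
    qed
    moreover have "\<forall>\<^sub>F n in sequentially. \<mu> < norm (zs n)"
    proof -
      have "ereal (\<tau> / 2) < ereal \<tau>" using \<tau>0 by simp
      also have "ereal \<tau> \<le> liminf (\<lambda>n. ereal (dual_norm N (zs n)))" using * by blast
      finally have "ereal (\<tau> / 2) < liminf (\<lambda>n. ereal (dual_norm N (zs n)))" .
      then have "\<forall>\<^sub>F n in sequentially. ereal (\<tau> / 2) < ereal (dual_norm N (zs n))"
        by (rule less_LiminfD)
      then show ?thesis
      proof eventually_elim
        case (elim n)
        then have "\<tau> / 2 < a * norm (zs n)" using F_le[of "zs n"] by simp
        then show ?case using pos by (simp add: \<mu>_def field_simps)
      qed
    qed
    ultimately have "\<forall>\<^sub>F n in sequentially. ereal (1 + (c - \<epsilon>)) \<le> ereal (dual_norm N (f + zs n))"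
    proof eventually_elim
      case (elim n)
      define g where "g k = osc (sc k) f" for k
      have "(\<Sum>k<K. 2 * g (Suc k) - D * g k + (5 * c - \<eta>)) \<le> (\<Sum>k<K. D * osc (sc k) (f + zs n))"
        using elim by (intro sum_mono) (auto simp: g_def algebra_simps)
      moreover have "(\<Sum>k<K. D * osc (sc k) (f + zs n)) = K * (D * dual_norm N (f + zs n))"
        using K(1) by (simp add: F flip: sum_distrib_left)
      moreover have G: "(\<Sum>k<K. g k) = K" using F[of f] * K(1) by (simp add: g_def field_simps)
      moreover have "(\<Sum>k<K. 2 * g (Suc k) - D * g k + (5 * c - \<eta>))
          = 2 * (K - g 0 + g K) - D * K + K * (5 * c - \<eta>)"
        using sum_shift_telescope[of g K] G
        by (simp add: sum.distrib sum_subtractf flip: sum_distrib_left)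
      moreover have "g 0 \<le> l"
      proof -
        have "g 0 \<le> norm f * a"
          unfolding g_def by (rule support_le[OF symmetric_bounded_difference_quotients[OF sct]])
        also have "\<dots> \<le> b * a" using F_ge[of f] * pos by (intro mult_right_mono) auto
        finally show ?thesis using l by (simp add: mult.commute)
      qed
      moreover have "0 \<le> g K" unfolding g_def by (rule osc_nonneg[OF sct])
      moreover have "2 * l \<le> \<eta> * K" using K(2) by (simp add: \<eta>_def)
      ultimately have "K * (2 - \<eta> - D + 5 * c - \<eta>) \<le> K * (D * dual_norm N (f + zs n))"
        by (simp add: algebra_simps)
      then have "2 - \<eta> - D + 5 * c - \<eta> \<le> D * dual_norm N (f + zs n)" using K(1) by simp
      \<comment> \<open>Apart from the errors, the left side is \<open>(1 + c)\<close> squared, at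
        most \<open>1 + 3 * c\<close> because \<open>c \<le> 1\<close>, and the right side is
        \<open>1 + 4 * c\<close>.\<close>
      moreover have "D * (1 + (c - \<epsilon>)) \<le> 2 - \<eta> - D + 5 * c - \<eta>"
      proof -
        have "c * c \<le> c" "0 \<le> \<epsilon> * c" "\<epsilon> * c \<le> \<epsilon>" "0 \<le> \<epsilon> * \<epsilon>"
          using c0 t1 \<epsilon> by (auto simp: mult_left_le)
        moreover have "D * (1 + (c - \<epsilon>)) = 1 + 2 * c + c * c - \<epsilon> - \<epsilon> * c + \<epsilon> / 9 + \<epsilon> * c / 9 - \<epsilon> * \<epsilon> / 9"
          by (simp add: D_def \<delta>_def field_simps)
        ultimately show ?thesis using c0 unfolding D_def \<delta>_def \<eta>_def by linarith
      qed
      ultimately have "D * (1 + (c - \<epsilon>)) \<le> D * dual_norm N (f + zs n)" by simp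
      moreover have "0 < D" using c0 pos' by (simp add: D_def)
      ultimately show ?case by simp
    qed
    then show "ereal (1 + (c - \<epsilon>)) \<le> liminf (\<lambda>n. ereal (dual_norm N (f + zs n)))"
      by (rule Liminf_bounded)
  qed
qed

end

theorem theorem5p3:
  fixes l \<epsilon> :: real
  assumes "separable_infinite_dimensional TYPE('a::banach)"
    and "separable_infinite_dimensional TYPE('b::banach)"
    and "uniformly_homeomorphic TYPE('a) TYPE('b)"
    and "l > unif_dist TYPE('a) TYPE('b)"
    and "\<epsilon> > 0"
  shows "\<exists>N :: 'b \<Rightarrow> real. equivalent_norm l N \<and>
    (\<forall>\<tau>. 0 \<le> \<tau> \<and> \<tau> \<le> 1 \<longrightarrow>
      theta N \<tau> \<ge> theta (norm :: 'a \<Rightarrow> real) (\<tau> / (32 * l\<^sup>2)) - \<epsilon>)"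
proof -
  note sepA = assms(1) and sepB = assms(2) and \<epsilon> = assms(5)
  have "\<exists>x :: 'a. x \<noteq> 0"
  proof (rule ccontr)
    assume "\<not> ?thesis"
    then have "span {} = (UNIV :: 'a set)" by auto
    then show False using sepA unfolding separable_infinite_dimensional_def by blast
  qed
  from uniform_homeomorphism_near_unif_dist[OF assms(3,4) this] obtain U :: "'a \<Rightarrow> 'b" and a b t0
    where U: "large_scale_Lipschitz_homeomorphism U a b t0" and ab: "a * b \<le> l" by blast
  interpret large_scale_Lipschitz_homeomorphism U a b t0 by (rule U)
  have l0: "0 < l" using mult_pos_pos[OF pos(1,2)] ab by simp
  define s0 where "s0 = max t0 (3 * b * t0 / \<epsilon>)"
  have s0: "t0 \<le> s0" "3 * b * t0 \<le> \<epsilon> * s0"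
    using \<epsilon> by (auto simp: s0_def pos_divide_le_eq[symmetric] mult.commute[of \<epsilon>])
  obtain K :: nat where "6 * l / \<epsilon> < K" using reals_Archimedean2 by blast
  moreover have "0 < 6 * l / \<epsilon>" using l0 \<epsilon> by simp
  ultimately have K_gt: "6 * l / \<epsilon> < K" and "0 < real K" by linarith+
  then have K: "0 < K" "2 * l \<le> \<epsilon> / 3 * K" using \<epsilon> by (auto simp: field_simps)
  obtain N where N: "equivalent_norm l N"
    and F: "\<And>f. dual_norm N f = (1 / real K) * (\<Sum>k<K. osc (4 ^ k * s0) f)"
    using averaged_renorming[OF ab K(1) s0(1)] by blast
  have "theta (norm :: 'a \<Rightarrow> real) (\<tau> / (32 * l\<^sup>2)) - \<epsilon> \<le> theta N \<tau>" if \<tau>: "0 \<le> \<tau>" "\<tau> \<le> 1" for \<tau>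
  proof -
    define t where "t = \<tau> / (32 * l\<^sup>2)"
    define c where "c = theta (norm :: 'a \<Rightarrow> real) t"
    have t: "0 \<le> t" using \<tau> by (simp add: t_def)
    have c: "theta_bound (norm :: 'a \<Rightarrow> real) t c"
      unfolding c_def by (rule theta_bound_theta[OF sepA equivalent_norm_norm t])
    have ct: "c \<le> t" by (rule theta_bound_le[OF sepA equivalent_norm_norm t c])
    have "theta_bound N \<tau> (c - \<epsilon>)" if c\<epsilon>: "\<epsilon> < c"
      by (rule theta_bound_average[OF sepA ab N K s0 F \<tau> c[unfolded t_def] ct[unfolded t_def] c\<epsilon> \<epsilon>])
    \<comment> \<open>For \<open>c \<le> \<epsilon>\<close> the trivial constant 0 suffices.\<close>
    then have "c - \<epsilon> \<le> theta N \<tau>"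
      using theta_ge[OF sepB N \<tau>(1)] theta_bound_0[OF N, of \<tau>] by fastforce
    then show ?thesis by (simp add: c_def t_def)
  qed
  then show ?thesis using N by blast
qed

end
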